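(* Let $E$ be a directed graph and $K$ a field. Then $L_K(E)$ is a locally finite $K$-algebra if and only if $E$ is acyclic.
   Context: A directed graph $E=(E^0,E^1,r,s)$ consists of sets $E^0$ (vertices), $E^1$ (edges), of arbitrary cardinality, and maps $r,s:E^1\to E^0$ (range, source). A vertex is regular if it emits at least one and only finitely many edges; $\mathrm{Reg}(E)$ is the set of regular vertices. A path of length $n\ge1$ is a sequence $e_1\cdots e_n$ of edges with $r(e_i)=s(e_{i+1})$. $E$ is acyclic if there is no path $\mu=e_1\cdots e_n$ with $n\ge1$ and $s(e_1)=r(e_n)$. The Leavitt path algebra $L_K(E)$ is the associative (not necessarily unital) $K$-algebra generated by $E^0\cup E^1\cup\{e^*: e\in E^1\}$ subject to: $vv'=\delta_{v,v'}v$ for $v,v'\in E^0$; $s(e)e=er(e)=e$ and $r(e)e^*=e^*s(e)=e^*$ for $e\in E^1$; $e^*f=\delta_{e,f}r(e)$ for $e,f\in E^1$; $v=\sum_{s(e)=v}ee^*$ for $v\in\mathrm{Reg}(E)$. An associative $K$-algebra $A$ is a locally finite $K$-algebra if every finite subset of $A$ is contained in a finite-dimensional (not necessarily unital) $K$-subalgebra of $A$. *)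

theory Defs
  imports "HOL-Algebra.Module" "HOL-Algebra.QuotRing" "Graph_Theory.Arc_Walk"
begin

section \<open>Associative, not necessarily unital algebras over a field\<close>

text \<open>
  The locale \<^locale>\<open>algebra\<close> of the library is commutative and unital. Here the field \<open>one\<close> of the
  record \<open>module\<close> carries no information.
\<close>

locale nonunital_algebra = field K + Module.module K A for K (structure) and A (structure) +
  assumes mult_closed:
      "\<lbrakk>x \<in> carrier A; y \<in> carrier A\<rbrakk> \<Longrightarrow> x \<otimes>\<^bsub>A\<^esub> y \<in> carrier A"
    and mult_assoc:
      "\<lbrakk>x \<in> carrier A; y \<in> carrier A; z \<in> carrier A\<rbrakk>
        \<Longrightarrow> (x \<otimes>\<^bsub>A\<^esub> y) \<otimes>\<^bsub>A\<^esub> z = x \<otimes>\<^bsub>A\<^esub> (y \<otimes>\<^bsub>A\<^esub> z)"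
    and mult_l_distr:
      "\<lbrakk>x \<in> carrier A; y \<in> carrier A; z \<in> carrier A\<rbrakk>
        \<Longrightarrow> (x \<oplus>\<^bsub>A\<^esub> y) \<otimes>\<^bsub>A\<^esub> z = x \<otimes>\<^bsub>A\<^esub> z \<oplus>\<^bsub>A\<^esub> y \<otimes>\<^bsub>A\<^esub> z"
    and mult_r_distr:
      "\<lbrakk>x \<in> carrier A; y \<in> carrier A; z \<in> carrier A\<rbrakk>
        \<Longrightarrow> z \<otimes>\<^bsub>A\<^esub> (x \<oplus>\<^bsub>A\<^esub> y) = z \<otimes>\<^bsub>A\<^esub> x \<oplus>\<^bsub>A\<^esub> z \<otimes>\<^bsub>A\<^esub> y"
    and smult_mult_l:
      "\<lbrakk>k \<in> carrier K; x \<in> carrier A; y \<in> carrier A\<rbrakk>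
        \<Longrightarrow> (k \<odot>\<^bsub>A\<^esub> x) \<otimes>\<^bsub>A\<^esub> y = k \<odot>\<^bsub>A\<^esub> (x \<otimes>\<^bsub>A\<^esub> y)"
    and smult_mult_r:
      "\<lbrakk>k \<in> carrier K; x \<in> carrier A; y \<in> carrier A\<rbrakk>
        \<Longrightarrow> x \<otimes>\<^bsub>A\<^esub> (k \<odot>\<^bsub>A\<^esub> y) = k \<odot>\<^bsub>A\<^esub> (x \<otimes>\<^bsub>A\<^esub> y)"

definition subalgebra_of ::
    "('a, 'c) ring_scheme \<Rightarrow> ('a, 'b, 'd) module_scheme \<Rightarrow> 'b set \<Rightarrow> bool" where
  "subalgebra_of K A B \<longleftrightarrow> submodule B K A \<and> (\<forall>x\<in>B. \<forall>y\<in>B. x \<otimes>\<^bsub>A\<^esub> y \<in> B)"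

definition lin_span ::
    "('a, 'c) ring_scheme \<Rightarrow> ('a, 'b, 'd) module_scheme \<Rightarrow> 'b set \<Rightarrow> 'b set" where
  "lin_span K A S =
     {\<Oplus>\<^bsub>A\<^esub>s\<in>T. c s \<odot>\<^bsub>A\<^esub> s | T c. finite T \<and> T \<subseteq> S \<and> c \<in> T \<rightarrow> carrier K}"

definition finite_dim ::
    "('a, 'c) ring_scheme \<Rightarrow> ('a, 'b, 'd) module_scheme \<Rightarrow> 'b set \<Rightarrow> bool" where
  "finite_dim K A B \<longleftrightarrow> (\<exists>S. finite S \<and> S \<subseteq> B \<and> lin_span K A S = B)"

definition locally_finite_algebra ::
    "('a, 'c) ring_scheme \<Rightarrow> ('a, 'b, 'd) module_scheme \<Rightarrow> bool" where
  "locally_finite_algebra K A \<longleftrightarrow>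
     (\<forall>S. finite S \<and> S \<subseteq> carrier A \<longrightarrow>
       (\<exists>B. subalgebra_of K A B \<and> finite_dim K A B \<and> S \<subseteq> B))"

definition algebra_ideal ::
    "('a, 'c) ring_scheme \<Rightarrow> ('a, 'b, 'd) module_scheme \<Rightarrow> 'b set \<Rightarrow> bool" where
  "algebra_ideal K A I \<longleftrightarrow>
     submodule I K A \<and> (\<forall>a\<in>carrier A. \<forall>x\<in>I. a \<otimes>\<^bsub>A\<^esub> x \<in> I \<and> x \<otimes>\<^bsub>A\<^esub> a \<in> I)"

definition ideal_generated_by ::
    "('a, 'c) ring_scheme \<Rightarrow> ('a, 'b, 'd) module_scheme \<Rightarrow> 'b set \<Rightarrow> 'b set" where
  "ideal_generated_by K A R = \<Inter>{I. algebra_ideal K A I \<and> R \<subseteq> I}"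

definition quotient_algebra ::
    "('a, 'b, 'd) module_scheme \<Rightarrow> 'b set \<Rightarrow> ('a, 'b set) module" where
  "quotient_algebra A I =
     \<lparr>carrier = a_rcosets\<^bsub>A\<^esub> I, mult = rcoset_mult A I, one = undefined, zero = I, add = set_add A,
      smult = (\<lambda>k X. \<Union>x\<in>X. I +>\<^bsub>A\<^esub> (k \<odot>\<^bsub>A\<^esub> x))\<rparr>"

text \<open>
  The free non-unital algebra on \<open>X\<close>: its elements are the finitely supported coefficient functions
  on the nonempty words over \<open>X\<close>, multiplied by convolution along concatenation of words.
\<close>

definition free_algebra ::
    "('a, 'c) ring_scheme \<Rightarrow> 'x set \<Rightarrow> ('a, 'x list \<Rightarrow> 'a) module" where
  "free_algebra K X =
     \<lparr>carrier = {f. range f \<subseteq> carrier K \<and> finite {w. f w \<noteq> \<zero>\<^bsub>K\<^esub>} \<and>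
                    {w. f w \<noteq> \<zero>\<^bsub>K\<^esub>} \<subseteq> lists X - {[]}},
      mult = (\<lambda>f g w. \<Oplus>\<^bsub>K\<^esub>i\<in>{..length w}. f (take i w) \<otimes>\<^bsub>K\<^esub> g (drop i w)),
      one = undefined,
      zero = (\<lambda>w. \<zero>\<^bsub>K\<^esub>),
      add = (\<lambda>f g w. f w \<oplus>\<^bsub>K\<^esub> g w),
      smult = (\<lambda>k f w. k \<otimes>\<^bsub>K\<^esub> f w)\<rparr>"

definition word_monomial :: "('a, 'c) ring_scheme \<Rightarrow> 'x list \<Rightarrow> 'x list \<Rightarrow> 'a" where
  "word_monomial K w = (\<lambda>u. if u = w then \<one>\<^bsub>K\<^esub> else \<zero>\<^bsub>K\<^esub>)"


section \<open>Leavitt path algebras\<close>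

text \<open>
  Source and range of an edge are \<^const>\<open>tail\<close> and \<^const>\<open>head\<close>; a directed graph of arbitrary
  cardinality is a \<^locale>\<open>wf_digraph\<close>.
\<close>

definition regular_vertices :: "('v, 'e) pre_digraph \<Rightarrow> 'v set" where
  "regular_vertices E = {v \<in> verts E. out_arcs E v \<noteq> {} \<and> finite (out_arcs E v)}"

definition acyclic_digraph :: "('v, 'e) pre_digraph \<Rightarrow> bool" where
  "acyclic_digraph E \<longleftrightarrow> \<not> (\<exists>u p. p \<noteq> [] \<and> pre_digraph.awalk E u p u)"

datatype ('v, 'e) lpa_gen = Vertex 'v | Edge 'e | Ghost 'e

definition lpa_generators :: "('v, 'e) pre_digraph \<Rightarrow> ('v, 'e) lpa_gen set" where
  "lpa_generators E = Vertex ` verts E \<union> Edge ` arcs E \<union> Ghost ` arcs E"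

text \<open>The pairs \<open>(a, b)\<close> of elements of the free algebra for which \<open>a = b\<close> is a defining relation.\<close>

inductive_set lpa_relations ::
    "('a, 'c) ring_scheme \<Rightarrow> ('v, 'e) pre_digraph \<Rightarrow>
      ((('v, 'e) lpa_gen list \<Rightarrow> 'a) \<times> (('v, 'e) lpa_gen list \<Rightarrow> 'a)) set"
  for K :: "('a, 'c) ring_scheme" and E :: "('v, 'e) pre_digraph" where
  vertex_idem: "v \<in> verts E \<Longrightarrow>
    (word_monomial K [Vertex v, Vertex v], word_monomial K [Vertex v]) \<in> lpa_relations K E"
| vertex_orth: "\<lbrakk>v \<in> verts E; v' \<in> verts E; v \<noteq> v'\<rbrakk> \<Longrightarrow>
    (word_monomial K [Vertex v, Vertex v'], \<lambda>w. \<zero>\<^bsub>K\<^esub>) \<in> lpa_relations K E"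
| source_edge: "e \<in> arcs E \<Longrightarrow>
    (word_monomial K [Vertex (tail E e), Edge e], word_monomial K [Edge e]) \<in> lpa_relations K E"
| edge_range: "e \<in> arcs E \<Longrightarrow>
    (word_monomial K [Edge e, Vertex (head E e)], word_monomial K [Edge e]) \<in> lpa_relations K E"
| range_ghost: "e \<in> arcs E \<Longrightarrow>
    (word_monomial K [Vertex (head E e), Ghost e], word_monomial K [Ghost e]) \<in> lpa_relations K E"
| ghost_source: "e \<in> arcs E \<Longrightarrow>
    (word_monomial K [Ghost e, Vertex (tail E e)], word_monomial K [Ghost e]) \<in> lpa_relations K E"
| ghost_edge_same: "e \<in> arcs E \<Longrightarrow>
    (word_monomial K [Ghost e, Edge e], word_monomial K [Vertex (head E e)]) \<in> lpa_relations K E"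
| ghost_edge_diff: "\<lbrakk>e \<in> arcs E; f \<in> arcs E; e \<noteq> f\<rbrakk> \<Longrightarrow>
    (word_monomial K [Ghost e, Edge f], \<lambda>w. \<zero>\<^bsub>K\<^esub>) \<in> lpa_relations K E"
| regular_vertex: "v \<in> regular_vertices E \<Longrightarrow>
    (word_monomial K [Vertex v],
     \<Oplus>\<^bsub>free_algebra K (lpa_generators E)\<^esub>e\<in>out_arcs E v. word_monomial K [Edge e, Ghost e])
      \<in> lpa_relations K E"

definition leavitt_ideal ::
    "('a, 'c) ring_scheme \<Rightarrow> ('v, 'e) pre_digraph \<Rightarrow> (('v, 'e) lpa_gen list \<Rightarrow> 'a) set" where
  "leavitt_ideal K E =
     ideal_generated_by K (free_algebra K (lpa_generators E))
       {a \<ominus>\<^bsub>free_algebra K (lpa_generators E)\<^esub> b | a b. (a, b) \<in> lpa_relations K E}"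

definition leavitt_path_algebra ::
    "('a, 'c) ring_scheme \<Rightarrow> ('v, 'e) pre_digraph \<Rightarrow>
      ('a, (('v, 'e) lpa_gen list \<Rightarrow> 'a) set) module" where
  "leavitt_path_algebra K E =
     quotient_algebra (free_algebra K (lpa_generators E)) (leavitt_ideal K E)"


section \<open>These structures are algebras\<close>

lemma (in abelian_monoid) finsum_triangle:
  assumes "\<And>i k. t i k \<in> carrier G"
  shows "(\<Oplus>k\<in>{..n::nat}. \<Oplus>i\<in>{..k}. t i k) = (\<Oplus>i\<in>{..n}. \<Oplus>j\<in>{..n - i}. t i (i + j))"
proof (induction n)
  case 0
  show ?case using assms by simp
next
  case (Suc n)
  have "(\<Oplus>i\<in>{..Suc n}. \<Oplus>j\<in>{..Suc n - i}. t i (i + j))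
      = t (Suc n) (Suc n) \<oplus> (\<Oplus>i\<in>{..n}. \<Oplus>j\<in>{..Suc n - i}. t i (i + j))"
    using assms by (simp add: finsum_Suc Pi_def)
  also have "(\<Oplus>i\<in>{..n}. \<Oplus>j\<in>{..Suc n - i}. t i (i + j))
      = (\<Oplus>i\<in>{..n}. t i (Suc n) \<oplus> (\<Oplus>j\<in>{..n - i}. t i (i + j)))"
    using assms by (intro finsum_cong') (auto simp: Suc_diff_le finsum_Suc Pi_def)
  also have "\<dots> = (\<Oplus>i\<in>{..n}. t i (Suc n)) \<oplus> (\<Oplus>i\<in>{..n}. \<Oplus>j\<in>{..n - i}. t i (i + j))"
    using assms by (intro finsum_addf) auto
  finally show ?case
    using Suc assms by (simp add: finsum_Suc Pi_def a_assoc)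
qed

lemma (in cring) free_algebra_mult_support:
  assumes "(f \<otimes>\<^bsub>free_algebra R X\<^esub> g) w \<noteq> \<zero>" "range f \<subseteq> carrier R" "range g \<subseteq> carrier R"
  shows "\<exists>u v. w = u @ v \<and> f u \<noteq> \<zero> \<and> g v \<noteq> \<zero>"
proof (rule ccontr)
  assume neg: "\<not> ?thesis"
  have c: "f u \<in> carrier R" "g u \<in> carrier R" for u using assms by auto
  have "f (take i w) \<otimes> g (drop i w) = \<zero>" for i
    using neg c by (metis append_take_drop_id l_null r_null)
  then have "(f \<otimes>\<^bsub>free_algebra R X\<^esub> g) w = \<zero>"
    by (simp add: free_algebra_def)
  then show False using assms by simp
qed

theorem free_nonunital_algebra:
  assumes "field K"
  shows "nonunital_algebra K (free_algebra K X)"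
proof -
  interpret K: field K by fact
  let ?F = "free_algebra K X"
  note fa = free_algebra_def
  have cf: "f w \<in> carrier K" if "f \<in> carrier ?F" for f w using that by (auto simp: fa)
  have fin: "finite {w. f w \<noteq> \<zero>\<^bsub>K\<^esub>}" if "f \<in> carrier ?F" for f using that by (auto simp: fa)
  have sup: "w \<in> lists X \<and> w \<noteq> []" if "f \<in> carrier ?F" "f w \<noteq> \<zero>\<^bsub>K\<^esub>" for f w
    using that by (auto simp: fa)
  have I: "f \<in> carrier ?F" if "\<And>w. f w \<in> carrier K" "finite A" "\<And>w. f w \<noteq> \<zero>\<^bsub>K\<^esub> \<Longrightarrow> w \<in> A"
    "\<And>w. f w \<noteq> \<zero>\<^bsub>K\<^esub> \<Longrightarrow> w \<in> lists X \<and> w \<noteq> []" for f A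
  proof -
    have "{w. f w \<noteq> \<zero>\<^bsub>K\<^esub>} \<subseteq> A" using that by blast
    then have "finite {w. f w \<noteq> \<zero>\<^bsub>K\<^esub>}" using that(2) finite_subset by blast
    then show ?thesis using that by (auto simp: fa)
  qed
  have add: "f \<oplus>\<^bsub>?F\<^esub> g \<in> carrier ?F" if f: "f \<in> carrier ?F" and g: "g \<in> carrier ?F" for f g
  proof (rule I[where A = "{w. f w \<noteq> \<zero>\<^bsub>K\<^esub>} \<union> {w. g w \<noteq> \<zero>\<^bsub>K\<^esub>}"])
    fix w assume w: "(f \<oplus>\<^bsub>?F\<^esub> g) w \<noteq> \<zero>\<^bsub>K\<^esub>"
    have *: "f w \<noteq> \<zero>\<^bsub>K\<^esub> \<or> g w \<noteq> \<zero>\<^bsub>K\<^esub>"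
    proof (rule ccontr)
      assume "\<not> ?thesis"
      then have "(f \<oplus>\<^bsub>?F\<^esub> g) w = \<zero>\<^bsub>K\<^esub>" by (simp add: fa)
      with w show False by simp
    qed
    then show "w \<in> {w. f w \<noteq> \<zero>\<^bsub>K\<^esub>} \<union> {w. g w \<noteq> \<zero>\<^bsub>K\<^esub>}" by simp
    show "w \<in> lists X \<and> w \<noteq> []" using * sup[OF f] sup[OF g] by blast
  qed (use fin[OF f] fin[OF g] cf[OF f] cf[OF g] in \<open>auto simp: fa\<close>)
  have smul: "k \<odot>\<^bsub>?F\<^esub> f \<in> carrier ?F" if k: "k \<in> carrier K" and f: "f \<in> carrier ?F" for k f
  proof (rule I[where A = "{w. f w \<noteq> \<zero>\<^bsub>K\<^esub>}"])
    fix w assume w: "(k \<odot>\<^bsub>?F\<^esub> f) w \<noteq> \<zero>\<^bsub>K\<^esub>"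
    then have *: "f w \<noteq> \<zero>\<^bsub>K\<^esub>" using k by (auto simp: fa)
    then show "w \<in> {w. f w \<noteq> \<zero>\<^bsub>K\<^esub>}" by simp
    show "w \<in> lists X \<and> w \<noteq> []" using * sup[OF f] by blast
  qed (use fin[OF f] cf[OF f] k in \<open>auto simp: fa\<close>)
  have zero: "\<zero>\<^bsub>?F\<^esub> \<in> carrier ?F" by (rule I[where A = "{}"]) (auto simp: fa)
  have ab: "abelian_group ?F"
  proof (rule abelian_groupI)
    fix f assume f: "f \<in> carrier ?F"
    have "(\<ominus>\<^bsub>K\<^esub> \<one>\<^bsub>K\<^esub>) \<odot>\<^bsub>?F\<^esub> f \<oplus>\<^bsub>?F\<^esub> f = \<zero>\<^bsub>?F\<^esub>"
      using cf[OF f] by (auto simp: fa K.l_minus K.l_neg)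
    then show "\<exists>g\<in>carrier ?F. g \<oplus>\<^bsub>?F\<^esub> f = \<zero>\<^bsub>?F\<^esub>"
      using smul f by (metis K.add.inv_closed K.one_closed)
  next
    show "f \<oplus>\<^bsub>?F\<^esub> g \<in> carrier ?F" if "f \<in> carrier ?F" "g \<in> carrier ?F" for f g
      using add that .
    show "\<zero>\<^bsub>?F\<^esub> \<in> carrier ?F" by (rule zero)
  qed (auto simp: fa K.a_ac image_subset_iff)
  have mod: "Module.module K ?F"
    by (rule Module.moduleI[OF K.is_cring ab smul])
      (auto simp: fa K.l_distr K.r_distr K.m_assoc image_subset_iff)
  have mult: "f \<otimes>\<^bsub>?F\<^esub> g \<in> carrier ?F" if f: "f \<in> carrier ?F" and g: "g \<in> carrier ?F" for f g
  proof (rule I[where A = "(\<lambda>(u, v). u @ v) ` ({w. f w \<noteq> \<zero>\<^bsub>K\<^esub>} \<times> {w. g w \<noteq> \<zero>\<^bsub>K\<^esub>})"])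
    fix w assume "(f \<otimes>\<^bsub>?F\<^esub> g) w \<noteq> \<zero>\<^bsub>K\<^esub>"
    then obtain u v where *: "w = u @ v" "f u \<noteq> \<zero>\<^bsub>K\<^esub>" "g v \<noteq> \<zero>\<^bsub>K\<^esub>"
      using K.free_algebra_mult_support cf[OF f] cf[OF g] by (metis image_subsetI)
    then show "w \<in> (\<lambda>(u, v). u @ v) ` ({w. f w \<noteq> \<zero>\<^bsub>K\<^esub>} \<times> {w. g w \<noteq> \<zero>\<^bsub>K\<^esub>})" by force
    show "w \<in> lists X \<and> w \<noteq> []" using * sup[OF f] sup[OF g] by auto
  qed (use fin[OF f] fin[OF g] cf[OF f] cf[OF g] in \<open>auto simp: fa intro!: K.finsum_closed\<close>)
  have assoc: "(f \<otimes>\<^bsub>?F\<^esub> g) \<otimes>\<^bsub>?F\<^esub> h = f \<otimes>\<^bsub>?F\<^esub> (g \<otimes>\<^bsub>?F\<^esub> h)"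
    if f: "f \<in> carrier ?F" and g: "g \<in> carrier ?F" and h: "h \<in> carrier ?F" for f g h
  proof
    fix w
    note [simp] = cf[OF f] cf[OF g] cf[OF h]
    let ?t = "\<lambda>i k. f (take i w) \<otimes>\<^bsub>K\<^esub> (g (take (k - i) (drop i w)) \<otimes>\<^bsub>K\<^esub> h (drop k w))"
    have "((f \<otimes>\<^bsub>?F\<^esub> g) \<otimes>\<^bsub>?F\<^esub> h) w
        = (\<Oplus>\<^bsub>K\<^esub>k\<in>{..length w}. (\<Oplus>\<^bsub>K\<^esub>i\<in>{..k}. f (take i (take k w)) \<otimes>\<^bsub>K\<^esub> g (drop i (take k w)))
            \<otimes>\<^bsub>K\<^esub> h (drop k w))"
      by (auto simp: fa min_def intro!: K.finsum_cong')
    also have "\<dots> = (\<Oplus>\<^bsub>K\<^esub>k\<in>{..length w}. \<Oplus>\<^bsub>K\<^esub>i\<in>{..k}. ?t i k)"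
      by (auto simp: K.finsum_ldistr Pi_def min_def drop_take K.m_assoc intro!: K.finsum_cong')
    also have "\<dots> = (\<Oplus>\<^bsub>K\<^esub>i\<in>{..length w}. \<Oplus>\<^bsub>K\<^esub>j\<in>{..length w - i}. ?t i (i + j))"
      by (rule K.finsum_triangle) simp
    also have "\<dots> = (f \<otimes>\<^bsub>?F\<^esub> (g \<otimes>\<^bsub>?F\<^esub> h)) w"
      by (auto simp: fa K.finsum_rdistr Pi_def add.commute intro!: K.finsum_cong')
    finally show "((f \<otimes>\<^bsub>?F\<^esub> g) \<otimes>\<^bsub>?F\<^esub> h) w = (f \<otimes>\<^bsub>?F\<^esub> (g \<otimes>\<^bsub>?F\<^esub> h)) w" .
  qed
  show ?thesis
  proof (rule nonunital_algebra.intro[OF assms mod], unfold_locales)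
    fix f g h assume f: "f \<in> carrier ?F" and g: "g \<in> carrier ?F" and h: "h \<in> carrier ?F"
    note [simp] = cf[OF f] cf[OF g] cf[OF h]
    show "f \<otimes>\<^bsub>?F\<^esub> g \<in> carrier ?F" using mult f g .
    show "(f \<otimes>\<^bsub>?F\<^esub> g) \<otimes>\<^bsub>?F\<^esub> h = f \<otimes>\<^bsub>?F\<^esub> (g \<otimes>\<^bsub>?F\<^esub> h)" using assoc f g h .
    show "(f \<oplus>\<^bsub>?F\<^esub> g) \<otimes>\<^bsub>?F\<^esub> h = f \<otimes>\<^bsub>?F\<^esub> h \<oplus>\<^bsub>?F\<^esub> g \<otimes>\<^bsub>?F\<^esub> h"
      by (rule ext) (simp add: fa K.l_distr K.finsum_addf Pi_def)
    show "h \<otimes>\<^bsub>?F\<^esub> (f \<oplus>\<^bsub>?F\<^esub> g) = h \<otimes>\<^bsub>?F\<^esub> f \<oplus>\<^bsub>?F\<^esub> h \<otimes>\<^bsub>?F\<^esub> g"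
      by (rule ext) (simp add: fa K.r_distr K.finsum_addf Pi_def)
  next
    fix k f g assume k: "k \<in> carrier K" and f: "f \<in> carrier ?F" and g: "g \<in> carrier ?F"
    note [simp] = cf[OF f] cf[OF g] k
    show "(k \<odot>\<^bsub>?F\<^esub> f) \<otimes>\<^bsub>?F\<^esub> g = k \<odot>\<^bsub>?F\<^esub> (f \<otimes>\<^bsub>?F\<^esub> g)"
      by (rule ext) (simp add: fa K.m_assoc K.finsum_rdistr Pi_def)
    show "f \<otimes>\<^bsub>?F\<^esub> (k \<odot>\<^bsub>?F\<^esub> g) = k \<odot>\<^bsub>?F\<^esub> (f \<otimes>\<^bsub>?F\<^esub> g)"
      by (rule ext) (simp add: fa K.m_lcomm K.finsum_rdistr Pi_def)
  qed
qed

context nonunital_algebra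
begin

lemma ideal_abelian_subgroup:
  assumes "algebra_ideal K A I"
  shows "abelian_subgroup I A"
proof -
  have "additive_subgroup I A"
    using assms by (simp add: algebra_ideal_def additive_subgroup_def submodule_def)
  then show ?thesis by (rule abelian_subgroupI3) (rule M.abelian_group_axioms)
qed

lemma quotient_nonunital_algebra:
  assumes I: "algebra_ideal K A I"
  shows "nonunital_algebra K (quotient_algebra A I)"
proof -
  interpret I: abelian_subgroup I A using I by (rule ideal_abelian_subgroup)
  let ?Q = "quotient_algebra A I"
  have absorb: "a \<otimes>\<^bsub>A\<^esub> x \<in> I" "x \<otimes>\<^bsub>A\<^esub> a \<in> I" if "a \<in> carrier A" "x \<in> I" for a x
    using I that by (auto simp: algebra_ideal_def)
  have scal: "k \<odot>\<^bsub>A\<^esub> x \<in> I" if "k \<in> carrier K" "x \<in> I" for k x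
    using I that by (auto simp: algebra_ideal_def submodule.smult_closed)
  have cong: "I +>\<^bsub>A\<^esub> (i \<oplus>\<^bsub>A\<^esub> x) = I +>\<^bsub>A\<^esub> x" if "i \<in> I" "x \<in> carrier A" for i x
    using that by (metis M.add.coset_mult_assoc I.a_subset I.a_Hcarr I.a_rcos_const a_r_coset_def M.a_coset_add_assoc)
  have coset: "\<exists>i\<in>I. y = i \<oplus>\<^bsub>A\<^esub> x" if "y \<in> I +>\<^bsub>A\<^esub> x" for x y
    using that by (auto simp: a_r_coset_def')
  have self: "x \<in> I +>\<^bsub>A\<^esub> x" if "x \<in> carrier A" for x
    using that by (rule I.a_rcos_self)
  have mult: "(I +>\<^bsub>A\<^esub> x) \<otimes>\<^bsub>?Q\<^esub> (I +>\<^bsub>A\<^esub> y) = I +>\<^bsub>A\<^esub> (x \<otimes>\<^bsub>A\<^esub> y)"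
    if x: "x \<in> carrier A" and y: "y \<in> carrier A" for x y
  proof -
    have "I +>\<^bsub>A\<^esub> (a \<otimes>\<^bsub>A\<^esub> b) = I +>\<^bsub>A\<^esub> (x \<otimes>\<^bsub>A\<^esub> y)"
      if a: "a \<in> I +>\<^bsub>A\<^esub> x" and b: "b \<in> I +>\<^bsub>A\<^esub> y" for a b
    proof -
      obtain i j where ij: "i \<in> I" "a = i \<oplus>\<^bsub>A\<^esub> x" "j \<in> I" "b = j \<oplus>\<^bsub>A\<^esub> y"
        using coset a b by blast
      have ic: "i \<in> carrier A" "j \<in> carrier A" using ij I.a_Hcarr by auto
      have bc: "b \<in> carrier A" using ij ic y by simp
      have "a \<otimes>\<^bsub>A\<^esub> b = i \<otimes>\<^bsub>A\<^esub> b \<oplus>\<^bsub>A\<^esub> x \<otimes>\<^bsub>A\<^esub> b"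
        using ij(2) mult_l_distr[OF ic(1) x bc] by simp
      also have "x \<otimes>\<^bsub>A\<^esub> b = x \<otimes>\<^bsub>A\<^esub> j \<oplus>\<^bsub>A\<^esub> x \<otimes>\<^bsub>A\<^esub> y"
        using ij(4) mult_r_distr[OF ic(2) y x] by simp
      finally have "a \<otimes>\<^bsub>A\<^esub> b = (i \<otimes>\<^bsub>A\<^esub> b \<oplus>\<^bsub>A\<^esub> x \<otimes>\<^bsub>A\<^esub> j) \<oplus>\<^bsub>A\<^esub> x \<otimes>\<^bsub>A\<^esub> y"
        using ic x y bc by (simp only: M.a_assoc mult_closed)
      moreover have "i \<otimes>\<^bsub>A\<^esub> b \<oplus>\<^bsub>A\<^esub> x \<otimes>\<^bsub>A\<^esub> j \<in> I"
        using ij ic x y by (intro I.a_closed absorb) auto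
      ultimately show ?thesis using cong x y by (simp add: mult_closed)
    qed
    then have "(\<Union>a\<in>I +>\<^bsub>A\<^esub> x. \<Union>b\<in>I +>\<^bsub>A\<^esub> y. I +>\<^bsub>A\<^esub> (a \<otimes>\<^bsub>A\<^esub> b))
        = (\<Union>a\<in>I +>\<^bsub>A\<^esub> x. \<Union>b\<in>I +>\<^bsub>A\<^esub> y. I +>\<^bsub>A\<^esub> (x \<otimes>\<^bsub>A\<^esub> y))"
      by (meson SUP_cong)
    also have "\<dots> = I +>\<^bsub>A\<^esub> (x \<otimes>\<^bsub>A\<^esub> y)" using self[OF x] self[OF y] by blast
    finally show ?thesis by (simp only: quotient_algebra_def rcoset_mult_def monoid.simps)
  qed
  have smul: "k \<odot>\<^bsub>?Q\<^esub> (I +>\<^bsub>A\<^esub> x) = I +>\<^bsub>A\<^esub> (k \<odot>\<^bsub>A\<^esub> x)"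
    if k: "k \<in> carrier K" and x: "x \<in> carrier A" for k x
  proof -
    have "I +>\<^bsub>A\<^esub> (k \<odot>\<^bsub>A\<^esub> a) = I +>\<^bsub>A\<^esub> (k \<odot>\<^bsub>A\<^esub> x)" if a: "a \<in> I +>\<^bsub>A\<^esub> x" for a
    proof -
      obtain i where i: "i \<in> I" "a = i \<oplus>\<^bsub>A\<^esub> x" using coset a by blast
      then have "k \<odot>\<^bsub>A\<^esub> a = k \<odot>\<^bsub>A\<^esub> i \<oplus>\<^bsub>A\<^esub> k \<odot>\<^bsub>A\<^esub> x"
        using k x I.a_Hcarr by (simp add: smult_r_distr)
      then show ?thesis using cong scal k x i by simp
    qed
    then have "(\<Union>a\<in>I +>\<^bsub>A\<^esub> x. I +>\<^bsub>A\<^esub> (k \<odot>\<^bsub>A\<^esub> a)) = (\<Union>a\<in>I +>\<^bsub>A\<^esub> x. I +>\<^bsub>A\<^esub> (k \<odot>\<^bsub>A\<^esub> x))"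
      by (meson SUP_cong)
    also have "\<dots> = I +>\<^bsub>A\<^esub> (k \<odot>\<^bsub>A\<^esub> x)" using self[OF x] by blast
    finally show ?thesis by (simp only: quotient_algebra_def module.simps)
  qed
  have add: "(I +>\<^bsub>A\<^esub> x) \<oplus>\<^bsub>?Q\<^esub> (I +>\<^bsub>A\<^esub> y) = I +>\<^bsub>A\<^esub> (x \<oplus>\<^bsub>A\<^esub> y)"
    if "x \<in> carrier A" "y \<in> carrier A" for x y
    using I.a_rcos_sum[OF that] by (simp add: quotient_algebra_def)
  have carr: "X \<in> carrier ?Q \<longleftrightarrow> (\<exists>x\<in>carrier A. X = I +>\<^bsub>A\<^esub> x)" for X
    by (auto simp: quotient_algebra_def A_RCOSETS_def')
  have zero: "\<zero>\<^bsub>?Q\<^esub> = I +>\<^bsub>A\<^esub> \<zero>\<^bsub>A\<^esub>"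
    using M.a_coset_add_zero[OF I.a_subset] by (simp add: quotient_algebra_def)
  have ab: "abelian_group ?Q"
  proof (rule abelian_groupI)
    fix X assume "X \<in> carrier ?Q"
    then obtain x where x: "x \<in> carrier A" "X = I +>\<^bsub>A\<^esub> x" by (auto simp: carr)
    then have "(I +>\<^bsub>A\<^esub> (\<ominus>\<^bsub>A\<^esub> x)) \<oplus>\<^bsub>?Q\<^esub> X = \<zero>\<^bsub>?Q\<^esub>"
      by (simp add: add zero M.l_neg)
    then show "\<exists>Y\<in>carrier ?Q. Y \<oplus>\<^bsub>?Q\<^esub> X = \<zero>\<^bsub>?Q\<^esub>" using x(1) carr M.a_inv_closed by blast
  next
    fix X Y assume "X \<in> carrier ?Q" "Y \<in> carrier ?Q"
    then show "X \<oplus>\<^bsub>?Q\<^esub> Y = Y \<oplus>\<^bsub>?Q\<^esub> X" by (auto simp: carr add M.a_comm)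
  qed (auto simp: carr add zero M.a_assoc)
  have mod: "Module.module K ?Q"
    by (rule Module.moduleI[OF is_cring ab])
      (auto simp: carr smul add smult_l_distr smult_r_distr smult_assoc1)
  show ?thesis
  proof (rule nonunital_algebra.intro[OF field_axioms mod], unfold_locales)
  qed (auto simp: carr smul add mult mult_closed mult_assoc mult_l_distr mult_r_distr
        smult_mult_l smult_mult_r)
qed

lemma ideal_generated_by_ideal:
  assumes "R \<subseteq> carrier A"
  shows "algebra_ideal K A (ideal_generated_by K A R)"
proof -
  let ?\<I> = "{I. algebra_ideal K A I \<and> R \<subseteq> I}"
  have sub: "submodule I K A" if "I \<in> ?\<I>" for I using that by (simp add: algebra_ideal_def)
  have top: "carrier A \<in> ?\<I>"
    using assms carrier_is_submodule by (auto simp: algebra_ideal_def mult_closed)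
  have zero: "\<zero>\<^bsub>A\<^esub> \<in> I" if "I \<in> ?\<I>" for I
    using subgroup.one_closed[of I "add_monoid A"] sub[OF that] by (simp add: submodule_def)
  have "submodule (\<Inter>?\<I>) K A"
  proof (rule submoduleI)
    show "\<Inter>?\<I> \<subseteq> carrier A" using top by blast
    show "\<zero>\<^bsub>A\<^esub> \<in> \<Inter>?\<I>" using zero by blast
    show "\<ominus>\<^bsub>A\<^esub> a \<in> \<Inter>?\<I>" if "a \<in> \<Inter>?\<I>" for a using that submoduleE(3)[OF sub] by blast
    show "a \<oplus>\<^bsub>A\<^esub> b \<in> \<Inter>?\<I>" if "a \<in> \<Inter>?\<I>" "b \<in> \<Inter>?\<I>" for a b
      using that submoduleE(5)[OF sub] by blast
    show "k \<odot>\<^bsub>A\<^esub> x \<in> \<Inter>?\<I>" if "k \<in> carrier K" "x \<in> \<Inter>?\<I>" for k x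
      using that submoduleE(4)[OF sub] by blast
  qed
  moreover have "a \<otimes>\<^bsub>A\<^esub> x \<in> \<Inter>?\<I> \<and> x \<otimes>\<^bsub>A\<^esub> a \<in> \<Inter>?\<I>"
    if "a \<in> carrier A" "x \<in> \<Inter>?\<I>" for a x
    using that by (auto simp: algebra_ideal_def)
  ultimately show ?thesis by (simp add: algebra_ideal_def ideal_generated_by_def)
qed

end

lemma (in cring) word_monomial_in_free_algebra:
  assumes "w \<in> lists X" "w \<noteq> []"
  shows "word_monomial R w \<in> carrier (free_algebra R X)"
proof -
  have sub: "{u. word_monomial R w u \<noteq> \<zero>} \<subseteq> {w}" by (auto simp: word_monomial_def)
  then have "finite {u. word_monomial R w u \<noteq> \<zero>}" using finite_subset by blast
  moreover have "{u. word_monomial R w u \<noteq> \<zero>} \<subseteq> lists X - {[]}" using sub assms by blast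
  ultimately show ?thesis by (auto simp: free_algebra_def word_monomial_def)
qed

theorem leavitt_path_algebra_nonunital_algebra:
  assumes "wf_digraph E" "field K"
  shows "nonunital_algebra K (leavitt_path_algebra K E)"
proof -
  interpret E: wf_digraph E by fact
  let ?X = "lpa_generators E"
  interpret F: nonunital_algebra K "free_algebra K ?X"
    using assms(2) by (rule free_nonunital_algebra)
  have mono: "word_monomial K w \<in> carrier (free_algebra K ?X)" if "w \<in> lists ?X" "w \<noteq> []" for w
    using that by (rule cring.word_monomial_in_free_algebra[OF F.is_cring])
  have zero: "(\<lambda>w. \<zero>\<^bsub>K\<^esub>) \<in> carrier (free_algebra K ?X)" by (simp add: free_algebra_def image_subset_iff)
  have gens: "Vertex v \<in> ?X \<longleftrightarrow> v \<in> verts E" "Edge e \<in> ?X \<longleftrightarrow> e \<in> arcs E"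
    "Ghost e \<in> ?X \<longleftrightarrow> e \<in> arcs E" for v e
    by (auto simp: lpa_generators_def)
  have "a \<in> carrier (free_algebra K ?X) \<and> b \<in> carrier (free_algebra K ?X)"
    if "(a, b) \<in> lpa_relations K E" for a b
    using that
    by cases (auto intro!: mono zero F.M.finsum_closed simp: gens regular_vertices_def)
  then have "algebra_ideal K (free_algebra K ?X) (leavitt_ideal K E)"
    unfolding leavitt_ideal_def by (intro F.ideal_generated_by_ideal) auto
  then show ?thesis
    unfolding leavitt_path_algebra_def by (rule F.quotient_nonunital_algebra)
qed

end

theory Submission
  imports Defs
begin

text \<open>
  If \<open>E\<close> is acyclic, then finitely many elements of \<open>L\<^sub>K(E)\<close> involve only finitely many vertices and
  arcs. Modulo the relations, every word in these generators and their ghosts is zero or of the form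
  \<open>\<alpha>\<beta>\<^sup>*\<close> with walks \<open>\<alpha>\<close>, \<open>\<beta>\<close> using these arcs only, so the elements \<open>\<alpha>\<beta>\<^sup>*\<close> span a subalgebra.
  A walk in an acyclic graph repeats no arc, so there are only finitely many of them; the relation
  at regular vertices plays no role here.

  Conversely, let \<open>p\<close> be a closed walk of positive length. \<open>L\<^sub>K(E)\<close> acts by partial injections on a
  set of points with an integer degree, where an arc lowers the degree by one and a ghost arc raises
  it by one and is defined at every point over its range. Hence \<open>(p\<^sup>*)\<^sup>n\<close> moves a suitable point by
  \<open>n \<bar>p\<bar>\<close> degrees. The displacements occurring in a finite-dimensional subspace are bounded, so no
  finite-dimensional subalgebra contains \<open>p\<^sup>*\<close>.
\<close>

section \<open>Submodules, spans and quotients\<close>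

context Module.module
begin

text \<open>Negation is multiplication by the scalar \<open>\<ominus> \<one>\<close>, so closure
  under negatives follows from closure under scalars.\<close>

lemma submodule_criterion:
  assumes "U \<subseteq> carrier M" "\<zero>\<^bsub>M\<^esub> \<in> U"
    and "\<And>x y. \<lbrakk>x \<in> U; y \<in> U\<rbrakk> \<Longrightarrow> x \<oplus>\<^bsub>M\<^esub> y \<in> U"
    and "\<And>k x. \<lbrakk>k \<in> carrier R; x \<in> U\<rbrakk> \<Longrightarrow> k \<odot>\<^bsub>M\<^esub> x \<in> U"
  shows "submodule U R M"
proof (rule submoduleI)
  fix x assume x: "x \<in> U"
  then have "\<ominus>\<^bsub>M\<^esub> x = (\<ominus> \<one>) \<odot>\<^bsub>M\<^esub> x"
    using assms(1) by (subst smult_l_minus) auto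
  then show "\<ominus>\<^bsub>M\<^esub> x \<in> U" using assms(4) x by simp
qed (use assms in auto)

lemma submodule_zero: "submodule U R M \<Longrightarrow> \<zero>\<^bsub>M\<^esub> \<in> U"
  using subgroup.one_closed[of U "add_monoid M"] by (simp add: submodule_def)

lemma submodule_finsum:
  assumes "submodule U R M" "\<And>i. i \<in> I \<Longrightarrow> f i \<in> U"
  shows "(\<Oplus>\<^bsub>M\<^esub>i\<in>I. f i) \<in> U"
  using assms(2)
proof (induction I rule: infinite_finite_induct)
  case (insert i I)
  then have "f ` insert i I \<subseteq> carrier M" using submoduleE(1)[OF assms(1)] by auto
  then have "(\<Oplus>\<^bsub>M\<^esub>i\<in>insert i I. f i) = f i \<oplus>\<^bsub>M\<^esub> (\<Oplus>\<^bsub>M\<^esub>i\<in>I. f i)"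
    using insert.hyps by (intro M.finsum_insert) auto
  then show ?case using insert submoduleE(5)[OF assms(1)] by simp
\<comment> \<open>A sum over an infinite index set is zero by convention, and zero lies in
  \<open>U\<close>.\<close>
qed (simp_all add: submodule_zero[OF assms(1)] M.finsum_infinite)

text \<open>This serves as an induction principle: a property passes from \<open>S\<close> to its
  span as soon as the elements having it form a submodule.\<close>

lemma lin_span_least:
  assumes "submodule U R M" "S \<subseteq> U"
  shows "lin_span R M S \<subseteq> U"
proof
  fix x assume "x \<in> lin_span R M S"
  then obtain T c where T: "T \<subseteq> S" "c \<in> T \<rightarrow> carrier R" "x = (\<Oplus>\<^bsub>M\<^esub>s\<in>T. c s \<odot>\<^bsub>M\<^esub> s)"
    by (auto simp: lin_span_def)
  show "x \<in> U" unfolding T(3)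
    using T(1,2) assms submoduleE(4)[OF assms(1)] by (intro submodule_finsum) (auto simp: Pi_iff subset_iff)
qed

lemma lin_span_superset:
  assumes "S \<subseteq> carrier M"
  shows "S \<subseteq> lin_span R M S"
proof
  fix s assume s: "s \<in> S"
  then have "s = (\<Oplus>\<^bsub>M\<^esub>x\<in>{s}. \<one> \<odot>\<^bsub>M\<^esub> x)" using assms by (auto simp: subset_iff)
  then show "s \<in> lin_span R M S"
    using s unfolding lin_span_def by (intro CollectI exI[of _ "{s}"] exI[of _ "\<lambda>_. \<one>"]) auto
qed

lemma lin_span_submodule:
  assumes S: "S \<subseteq> carrier M"
  shows "submodule (lin_span R M S) R M"
proof (rule submodule_criterion)
  show "lin_span R M S \<subseteq> carrier M"
    using carrier_is_submodule S by (rule lin_span_least)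
  show "\<zero>\<^bsub>M\<^esub> \<in> lin_span R M S"
    unfolding lin_span_def by (intro CollectI exI[of _ "{}"] exI[of _ "\<lambda>_. \<one>"]) auto
next
  fix k x assume k: "k \<in> carrier R" and "x \<in> lin_span R M S"
  then obtain T c where T: "finite T" "T \<subseteq> S" "c \<in> T \<rightarrow> carrier R"
      "x = (\<Oplus>\<^bsub>M\<^esub>s\<in>T. c s \<odot>\<^bsub>M\<^esub> s)"
    by (auto simp: lin_span_def)
  have "k \<odot>\<^bsub>M\<^esub> x = (\<Oplus>\<^bsub>M\<^esub>s\<in>T. k \<odot>\<^bsub>M\<^esub> (c s \<odot>\<^bsub>M\<^esub> s))"
    unfolding T(4) using k T S by (subst finsum_smult_ldistr) (auto simp: Pi_iff subset_iff)
  also have "\<dots> = (\<Oplus>\<^bsub>M\<^esub>s\<in>T. (k \<otimes> c s) \<odot>\<^bsub>M\<^esub> s)"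
    using k T S by (intro M.finsum_cong') (auto simp: smult_assoc1 Pi_iff subset_iff)
  finally show "k \<odot>\<^bsub>M\<^esub> x \<in> lin_span R M S"
    using k T unfolding lin_span_def
    by (intro CollectI exI[of _ T] exI[of _ "\<lambda>s. k \<otimes> c s"]) auto
next
  fix x y assume "x \<in> lin_span R M S" "y \<in> lin_span R M S"
  then obtain T c U d where T: "finite T" "T \<subseteq> S" "c \<in> T \<rightarrow> carrier R"
      "x = (\<Oplus>\<^bsub>M\<^esub>s\<in>T. c s \<odot>\<^bsub>M\<^esub> s)"
    and U: "finite U" "U \<subseteq> S" "d \<in> U \<rightarrow> carrier R" "y = (\<Oplus>\<^bsub>M\<^esub>s\<in>U. d s \<odot>\<^bsub>M\<^esub> s)"
    by (auto simp: lin_span_def)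
  \<comment> \<open>The two supports may differ, so coefficients are extended by zero to
    \<open>T \<union> U\<close>, where the sums can be added term by term.\<close>
  have extend: "(\<Oplus>\<^bsub>M\<^esub>s\<in>V. e s \<odot>\<^bsub>M\<^esub> s) = (\<Oplus>\<^bsub>M\<^esub>s\<in>T \<union> U. (if s \<in> V then e s else \<zero>) \<odot>\<^bsub>M\<^esub> s)"
    if "V \<subseteq> T \<union> U" "e \<in> V \<rightarrow> carrier R" for V e
    using that T(1,2) U(1,2) S
    by (intro M.add.finprod_mono_neutral_cong_left) (auto simp: Pi_iff subset_iff)
  let ?c = "\<lambda>s. if s \<in> T then c s else \<zero>" and ?d = "\<lambda>s. if s \<in> U then d s else \<zero>"
  have "x \<oplus>\<^bsub>M\<^esub> y = (\<Oplus>\<^bsub>M\<^esub>s\<in>T \<union> U. ?c s \<odot>\<^bsub>M\<^esub> s) \<oplus>\<^bsub>M\<^esub> (\<Oplus>\<^bsub>M\<^esub>s\<in>T \<union> U. ?d s \<odot>\<^bsub>M\<^esub> s)"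
    unfolding T(4) U(4) using extend[of T c] extend[of U d] T U by simp
  also have "\<dots> = (\<Oplus>\<^bsub>M\<^esub>s\<in>T \<union> U. ?c s \<odot>\<^bsub>M\<^esub> s \<oplus>\<^bsub>M\<^esub> ?d s \<odot>\<^bsub>M\<^esub> s)"
    using T U S by (intro M.finsum_addf[symmetric]) (auto simp: Pi_iff subset_iff)
  also have "\<dots> = (\<Oplus>\<^bsub>M\<^esub>s\<in>T \<union> U. (?c s \<oplus> ?d s) \<odot>\<^bsub>M\<^esub> s)"
    using T U S by (intro M.finsum_cong') (auto simp: smult_l_distr Pi_iff subset_iff)
  finally show "x \<oplus>\<^bsub>M\<^esub> y \<in> lin_span R M S"
    using T U unfolding lin_span_def
    by (intro CollectI exI[of _ "T \<union> U"] exI[of _ "\<lambda>s. ?c s \<oplus> ?d s"]) (auto simp: Pi_iff)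
qed

end

section \<open>Subalgebras and quotients of non-unital algebras\<close>

context nonunital_algebra
begin

lemma mult_zero [simp]:
  assumes "x \<in> carrier A"
  shows "\<zero>\<^bsub>A\<^esub> \<otimes>\<^bsub>A\<^esub> x = \<zero>\<^bsub>A\<^esub>" "x \<otimes>\<^bsub>A\<^esub> \<zero>\<^bsub>A\<^esub> = \<zero>\<^bsub>A\<^esub>"
proof -
  show "\<zero>\<^bsub>A\<^esub> \<otimes>\<^bsub>A\<^esub> x = \<zero>\<^bsub>A\<^esub>" 
    using smult_mult_l[of \<zero> "\<zero>\<^bsub>A\<^esub>" x] assms by (simp add: mult_closed)
  show "x \<otimes>\<^bsub>A\<^esub> \<zero>\<^bsub>A\<^esub> = \<zero>\<^bsub>A\<^esub>" 
    using smult_mult_r[of \<zero> x "\<zero>\<^bsub>A\<^esub>"] assms by (simp add: mult_closed)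
qed

text \<open>Multiplication is bilinear, so it is enough to multiply generators;
  \<open>lin_span_least\<close> is applied to one factor at a time, the left one first.\<close>

lemma lin_span_subalgebra:
  assumes S: "S \<subseteq> carrier A"
    and mult: "\<And>s t. \<lbrakk>s \<in> S; t \<in> S\<rbrakk> \<Longrightarrow> s \<otimes>\<^bsub>A\<^esub> t \<in> lin_span K A S"
  shows "subalgebra_of K A (lin_span K A S)"
proof -
  let ?B = "lin_span K A S"
  note B = lin_span_submodule[OF S]
  note B_carr = submoduleE(1)[OF B]
  have *: "x \<otimes>\<^bsub>A\<^esub> t \<in> ?B" if "x \<in> ?B" "t \<in> S" for x t
  proof -
    have "submodule {x \<in> carrier A. x \<otimes>\<^bsub>A\<^esub> t \<in> ?B} K A"
      using that S submodule_zero[OF B] submoduleE(4,5)[OF B]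
      by (intro submodule_criterion) (auto simp: mult_l_distr smult_mult_l subset_iff)
    then show ?thesis using lin_span_least[of _ S] that S mult by blast
  qed
  have "x \<otimes>\<^bsub>A\<^esub> y \<in> ?B" if "x \<in> ?B" "y \<in> ?B" for x y
  proof -
    have "submodule {y \<in> carrier A. x \<otimes>\<^bsub>A\<^esub> y \<in> ?B} K A"
      using that B_carr submodule_zero[OF B] submoduleE(4,5)[OF B]
      by (intro submodule_criterion) (auto simp: mult_r_distr smult_mult_r subset_iff)
    then show ?thesis using lin_span_least[of _ S] that S * by blast
  qed
  then show ?thesis using B by (simp add: subalgebra_of_def)
qed

lemma algebra_idealE:
  assumes "algebra_ideal K A I"
  shows "submodule I K A" "I \<subseteq> carrier A"
    "\<And>a x. \<lbrakk>a \<in> carrier A; x \<in> I\<rbrakk> \<Longrightarrow> a \<otimes>\<^bsub>A\<^esub> x \<in> I"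
    "\<And>a x. \<lbrakk>a \<in> carrier A; x \<in> I\<rbrakk> \<Longrightarrow> x \<otimes>\<^bsub>A\<^esub> a \<in> I"
  using assms submoduleE(1) by (auto simp: algebra_ideal_def)

context
  fixes I
  assumes I: "algebra_ideal K A I"
begin

interpretation abelian_subgroup I A using I by (rule ideal_abelian_subgroup)

lemma coset_iff: "y \<in> I +>\<^bsub>A\<^esub> x \<longleftrightarrow> (\<exists>i\<in>I. y = i \<oplus>\<^bsub>A\<^esub> x)"
  by (auto simp: a_r_coset_def')

lemma coset_eqI:
  assumes "i \<in> I" "x \<in> carrier A" "y = i \<oplus>\<^bsub>A\<^esub> x"
  shows "I +>\<^bsub>A\<^esub> y = I +>\<^bsub>A\<^esub> x"
  using assms by (intro a_repr_independence'[symmetric]) (auto simp: coset_iff)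

lemma coset_eqD:
  assumes "x \<in> carrier A" "I +>\<^bsub>A\<^esub> x = I +>\<^bsub>A\<^esub> y"
  shows "\<exists>i\<in>I. x = i \<oplus>\<^bsub>A\<^esub> y"
  using a_rcos_self[OF assms(1)] assms(2) by (simp add: coset_iff)

lemma quotient_carrier: "carrier (quotient_algebra A I) = (\<lambda>x. I +>\<^bsub>A\<^esub> x) ` carrier A"
  by (auto simp: quotient_algebra_def A_RCOSETS_def')

lemma quotient_zero: "\<zero>\<^bsub>quotient_algebra A I\<^esub> = I +>\<^bsub>A\<^esub> \<zero>\<^bsub>A\<^esub>"
  using M.a_coset_add_zero[OF a_subset] by (simp add: quotient_algebra_def)

lemma quotient_add:
  assumes "x \<in> carrier A" "y \<in> carrier A"
  shows "(I +>\<^bsub>A\<^esub> x) \<oplus>\<^bsub>quotient_algebra A I\<^esub> (I +>\<^bsub>A\<^esub> y) = I +>\<^bsub>A\<^esub> (x \<oplus>\<^bsub>A\<^esub> y)"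
  using a_rcos_sum[OF assms] by (simp add: quotient_algebra_def)

text \<open>The operation on cosets is a union over all representatives; its members all coincide
  because \<open>I\<close> is closed under scalars.\<close>

lemma quotient_smult:
  assumes k: "k \<in> carrier K" and x: "x \<in> carrier A"
  shows "k \<odot>\<^bsub>quotient_algebra A I\<^esub> (I +>\<^bsub>A\<^esub> x) = I +>\<^bsub>A\<^esub> (k \<odot>\<^bsub>A\<^esub> x)"
proof -
  have "I +>\<^bsub>A\<^esub> (k \<odot>\<^bsub>A\<^esub> a) = I +>\<^bsub>A\<^esub> (k \<odot>\<^bsub>A\<^esub> x)" if a: "a \<in> I +>\<^bsub>A\<^esub> x" for a
  proof -
    obtain i where i: "i \<in> I" "a = i \<oplus>\<^bsub>A\<^esub> x" using a by (auto simp: coset_iff)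
    then show ?thesis
      using k x submoduleE(4)[OF algebra_idealE(1)[OF I]]
      by (intro coset_eqI[of "k \<odot>\<^bsub>A\<^esub> i"]) (auto simp: smult_r_distr)
  qed
  then have "(\<Union>a\<in>I +>\<^bsub>A\<^esub> x. I +>\<^bsub>A\<^esub> (k \<odot>\<^bsub>A\<^esub> a)) = I +>\<^bsub>A\<^esub> (k \<odot>\<^bsub>A\<^esub> x)"
    using a_rcos_self[OF x] by blast
  then show ?thesis by (simp only: quotient_algebra_def module.simps)
qed

text \<open>Again the union over representatives collapses to one coset, here because
  \<open>I\<close> absorbs products from both sides.\<close>

lemma quotient_mult:
  assumes x: "x \<in> carrier A" and y: "y \<in> carrier A"
  shows "(I +>\<^bsub>A\<^esub> x) \<otimes>\<^bsub>quotient_algebra A I\<^esub> (I +>\<^bsub>A\<^esub> y) = I +>\<^bsub>A\<^esub> (x \<otimes>\<^bsub>A\<^esub> y)"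
proof -
  have "I +>\<^bsub>A\<^esub> (a \<otimes>\<^bsub>A\<^esub> b) = I +>\<^bsub>A\<^esub> (x \<otimes>\<^bsub>A\<^esub> y)"
    if a: "a \<in> I +>\<^bsub>A\<^esub> x" and b: "b \<in> I +>\<^bsub>A\<^esub> y" for a b
  proof -
    obtain i j where ij: "i \<in> I" "a = i \<oplus>\<^bsub>A\<^esub> x" "j \<in> I" "b = j \<oplus>\<^bsub>A\<^esub> y"
      using a b by (auto simp: coset_iff)
    have ic: "i \<in> carrier A" "j \<in> carrier A" using ij a_Hcarr by auto
    show ?thesis
    proof (rule coset_eqI)
      show "i \<otimes>\<^bsub>A\<^esub> b \<oplus>\<^bsub>A\<^esub> x \<otimes>\<^bsub>A\<^esub> j \<in> I"
        using ij ic x y algebra_idealE(3,4)[OF I] by (intro a_closed) auto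
      show "a \<otimes>\<^bsub>A\<^esub> b = (i \<otimes>\<^bsub>A\<^esub> b \<oplus>\<^bsub>A\<^esub> x \<otimes>\<^bsub>A\<^esub> j) \<oplus>\<^bsub>A\<^esub> x \<otimes>\<^bsub>A\<^esub> y"
        using ic x y by (simp add: ij(2,4) mult_l_distr mult_r_distr mult_closed M.a_ac)
    qed (use x y in \<open>simp add: mult_closed\<close>)
  qed
  then have "(\<Union>a\<in>I +>\<^bsub>A\<^esub> x. \<Union>b\<in>I +>\<^bsub>A\<^esub> y. I +>\<^bsub>A\<^esub> (a \<otimes>\<^bsub>A\<^esub> b)) = I +>\<^bsub>A\<^esub> (x \<otimes>\<^bsub>A\<^esub> y)"
    using a_rcos_self[OF x] a_rcos_self[OF y] by blast
  then show ?thesis by (simp only: quotient_algebra_def rcoset_mult_def monoid.simps)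
qed

end

end

section \<open>The free algebra\<close>

locale free_nonunital = field K for K (structure) +
  fixes X :: "'x set"
begin

abbreviation FA where "FA \<equiv> free_algebra K X"
abbreviation monomial where "monomial \<equiv> word_monomial K"

sublocale F: nonunital_algebra K FA
  by (rule free_nonunital_algebra[OF field_axioms])

lemma coeff_closed [simp]: "f \<in> carrier FA \<Longrightarrow> f w \<in> carrier K"
  by (simp add: free_algebra_def image_subset_iff)

lemma finite_support: "f \<in> carrier FA \<Longrightarrow> finite {w. f w \<noteq> \<zero>}"
  by (simp add: free_algebra_def)

lemma support_words: "f \<in> carrier FA \<Longrightarrow> f w \<noteq> \<zero> \<Longrightarrow> w \<in> lists X - {[]}"
  unfolding free_algebra_def by force

lemma free_algebra_apply:
  "(f \<oplus>\<^bsub>FA\<^esub> g) w = f w \<oplus> g w" "(k \<odot>\<^bsub>FA\<^esub> f) w = k \<otimes> f w" "\<zero>\<^bsub>FA\<^esub> w = \<zero>"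
  by (simp_all add: free_algebra_def)

lemma monomial_closed: "w \<in> lists X - {[]} \<Longrightarrow> monomial w \<in> carrier FA"
  by (simp add: word_monomial_in_free_algebra)

text \<open>Of all the cuts of \<open>w\<close> in the convolution, only the one after
  \<open>length u\<close> letters can match \<open>u\<close> and \<open>v\<close>.\<close>

lemma monomial_mult: "monomial u \<otimes>\<^bsub>FA\<^esub> monomial v = monomial (u @ v)"
proof
  fix w
  have eq: "monomial u (take i w) \<otimes> monomial v (drop i w) = (if i = length u then monomial (u @ v) w else \<zero>)"
    if "i \<le> length w" for i
  proof -
    have iff: "take i w = u \<and> drop i w = v \<longleftrightarrow> i = length u \<and> w = u @ v"
      using that by (metis append_eq_conv_conj append_take_drop_id length_take min.absorb2)
    have "monomial u (take i w) \<otimes> monomial v (drop i w)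
        = (if take i w = u \<and> drop i w = v then \<one> else \<zero>)"
      by (simp add: word_monomial_def)
    then show ?thesis unfolding iff by (simp add: word_monomial_def)
  qed
  have "(monomial u \<otimes>\<^bsub>FA\<^esub> monomial v) w
      = (\<Oplus>i\<in>{..length w}. monomial u (take i w) \<otimes> monomial v (drop i w))"
    by (simp add: free_algebra_def)
  also have "\<dots> = (\<Oplus>i\<in>{..length w}. if i = length u then monomial (u @ v) w else \<zero>)"
    using eq by (intro finsum_cong') (auto simp: word_monomial_def)
  also have "\<dots> = monomial (u @ v) w"
  \<comment> \<open>If \<open>w\<close> is shorter than \<open>u\<close>, that cut lies outside the
    summation range, but then \<open>w \<noteq> u @ v\<close> and both sides vanish.\<close>
  proof (cases "length u \<le> length w")
    case True
    then show ?thesis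
      by (intro add.finprod_singleton_swap) (auto simp: word_monomial_def)
  next
    case False
    then have "monomial (u @ v) w = \<zero>" by (auto simp: word_monomial_def)
    then show ?thesis by (simp only: if_cancel finsum_zero)
  qed
  finally show "(monomial u \<otimes>\<^bsub>FA\<^esub> monomial v) w = monomial (u @ v) w" .
qed

text \<open>The monomials split off all come from the support of the given \<open>f\<close>; the
  step case records this, so that facts about the words of \<open>f\<close> can be used.\<close>

lemma free_algebra_induct [consumes 1, case_names zero add]:
  assumes f: "f \<in> carrier FA"
    and zero: "P \<zero>\<^bsub>FA\<^esub>"
    and add: "\<And>k w g. \<lbrakk>k \<in> carrier K; f w \<noteq> \<zero>; w \<in> lists X - {[]}; g \<in> carrier FA; P g\<rbrakk>
      \<Longrightarrow> P (k \<odot>\<^bsub>FA\<^esub> monomial w \<oplus>\<^bsub>FA\<^esub> g)"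
  shows "P f"
proof -
  have "P g" if "finite W" "g \<in> carrier FA" "{w. g w \<noteq> \<zero>} \<subseteq> W" "W \<subseteq> {w. f w \<noteq> \<zero>}" for g W
    using that
  proof (induction W arbitrary: g rule: finite_induct)
    case empty
    then have "g = \<zero>\<^bsub>FA\<^esub>" by (auto simp: free_algebra_apply)
    then show ?case using zero by simp
  next
    case (insert w W)
    have w: "f w \<noteq> \<zero>" "w \<in> lists X - {[]}" using insert.prems support_words[OF f] by auto
    \<comment> \<open>Subtracting the \<open>w\<close> term shrinks the support to \<open>W\<close>;
      the induction hypothesis applies to \<open>h\<close>, and adding the term back recovers
      \<open>g\<close>.\<close>
    define h where "h = (\<ominus> g w) \<odot>\<^bsub>FA\<^esub> monomial w \<oplus>\<^bsub>FA\<^esub> g"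
    have h: "h \<in> carrier FA" using insert.prems(1) monomial_closed[OF w(2)] by (simp add: h_def)
    have "h w = \<zero>" using insert.prems(1) by (simp add: h_def free_algebra_apply word_monomial_def l_neg)
    moreover have "h v = g v" if "v \<noteq> w" for v
      using that insert.prems(1) by (simp add: h_def free_algebra_apply word_monomial_def)
    ultimately have supp: "v \<in> W" if "h v \<noteq> \<zero>" for v
      using that insert.prems(2) by (cases "v = w") auto
    then have "P h" using insert.prems(3) by (intro insert.IH h) auto
    then have "P (g w \<odot>\<^bsub>FA\<^esub> monomial w \<oplus>\<^bsub>FA\<^esub> h)"
      using insert.prems(1) h w by (intro add) auto
    also have "g w \<odot>\<^bsub>FA\<^esub> monomial w \<oplus>\<^bsub>FA\<^esub> h = g"
      using insert.prems(1) monomial_closed[OF w(2)] F.smult_l_distr[of "g w" "\<ominus> g w" "monomial w"]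
      by (simp add: h_def F.M.a_assoc[symmetric] r_neg)
    finally show ?case .
  qed
  from this[OF finite_support[OF f] f] show ?thesis by simp
qed

lemma in_submoduleI:
  assumes U: "submodule U K FA" and f: "f \<in> carrier FA" and "\<And>w. f w \<noteq> \<zero> \<Longrightarrow> monomial w \<in> U"
  shows "f \<in> U"
  using f
proof (induction rule: free_algebra_induct)
  case zero
  show ?case using F.submodule_zero[OF U] .
next
  case (add k w g)
  then show ?case using assms(3) F.submoduleE(4,5)[OF U] by blast
qed

section \<open>Linear functionals on the free algebra\<close>

definition lin_ext where
  "lin_ext h f = (\<Oplus>w\<in>{w. f w \<noteq> \<zero>}. f w \<otimes> h w)"

context
  fixes h :: "'x list \<Rightarrow> 'a"
  assumes h [simp]: "\<And>w. h w \<in> carrier K"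
begin

lemma lin_ext_superset:
  assumes "f \<in> carrier FA" "finite W" "{w. f w \<noteq> \<zero>} \<subseteq> W"
  shows "lin_ext h f = (\<Oplus>w\<in>W. f w \<otimes> h w)"
  unfolding lin_ext_def using assms by (intro add.finprod_mono_neutral_cong_left) auto

lemma lin_ext_closed [simp]: "f \<in> carrier FA \<Longrightarrow> lin_ext h f \<in> carrier K"
  by (auto simp: lin_ext_def)

lemma lin_ext_zero [simp]: "lin_ext h \<zero>\<^bsub>FA\<^esub> = \<zero>"
  by (simp add: lin_ext_def free_algebra_apply)

lemma lin_ext_add [simp]:
  assumes "f \<in> carrier FA" "g \<in> carrier FA"
  shows "lin_ext h (f \<oplus>\<^bsub>FA\<^esub> g) = lin_ext h f \<oplus> lin_ext h g"
proof -
  let ?W = "{w. f w \<noteq> \<zero>} \<union> {w. g w \<noteq> \<zero>}"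
  have W: "finite ?W" using assms finite_support by simp
  have "{w. (f \<oplus>\<^bsub>FA\<^esub> g) w \<noteq> \<zero>} \<subseteq> ?W" by (auto simp: free_algebra_apply)
  then show ?thesis
    using assms lin_ext_superset[OF _ W]
    by (simp add: free_algebra_apply l_distr finsum_addf Pi_def)
qed

lemma lin_ext_smult [simp]:
  assumes "k \<in> carrier K" "f \<in> carrier FA"
  shows "lin_ext h (k \<odot>\<^bsub>FA\<^esub> f) = k \<otimes> lin_ext h f"
proof -
  have "{w. (k \<odot>\<^bsub>FA\<^esub> f) w \<noteq> \<zero>} \<subseteq> {w. f w \<noteq> \<zero>}" using assms(1) by (auto simp: free_algebra_apply)
  then have "lin_ext h (k \<odot>\<^bsub>FA\<^esub> f) = (\<Oplus>w\<in>{w. f w \<noteq> \<zero>}. (k \<odot>\<^bsub>FA\<^esub> f) w \<otimes> h w)"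
    using assms finite_support by (intro lin_ext_superset) auto
  then show ?thesis
    using assms finite_support by (simp add: lin_ext_def finsum_rdistr m_assoc free_algebra_apply Pi_def)
qed

lemma lin_ext_minus:
  assumes "f \<in> carrier FA" "g \<in> carrier FA"
  shows "lin_ext h (f \<ominus>\<^bsub>FA\<^esub> g) = lin_ext h f \<ominus> lin_ext h g"
proof -
  have "\<ominus>\<^bsub>FA\<^esub> g = (\<ominus> \<one>) \<odot>\<^bsub>FA\<^esub> g" using assms F.smult_l_minus[of \<one> g] by simp
  then have "lin_ext h (\<ominus>\<^bsub>FA\<^esub> g) = (\<ominus> \<one>) \<otimes> lin_ext h g" using assms by simp
  then show ?thesis using assms by (simp add: a_minus_def l_minus)
qed

lemma lin_ext_monomial [simp]:
  "lin_ext h (monomial w) = h w"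
proof -
  have "{v. monomial w v \<noteq> \<zero>} = {w}" by (auto simp: word_monomial_def)
  then show ?thesis by (simp add: lin_ext_def) (simp add: word_monomial_def)
qed

lemma lin_ext_finsum:
  assumes "\<And>i. i \<in> I \<Longrightarrow> f i \<in> carrier FA"
  shows "lin_ext h (\<Oplus>\<^bsub>FA\<^esub>i\<in>I. f i) = (\<Oplus>i\<in>I. lin_ext h (f i))"
  using assms
proof (induction I rule: infinite_finite_induct)
  case (insert i I)
  then show ?case using F.M.finsum_insert[of I i f] by (simp add: Pi_def)
qed (simp_all add: F.M.finsum_infinite)

lemma lin_ext_eq_zeroI: "(\<And>w. f w \<noteq> \<zero> \<Longrightarrow> f w \<otimes> h w = \<zero>) \<Longrightarrow> lin_ext h f = \<zero>"
  unfolding lin_ext_def by (auto intro: add.finprod_one_eqI)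

end

text \<open>Both sides are linear in \<open>f\<close> and in \<open>g\<close>, so the claim reduces
  to monomials, whose product is the monomial of the concatenated word.\<close>

lemma lin_ext_mult:
  assumes h [simp]: "\<And>w. h w \<in> carrier K"
    and f: "f \<in> carrier FA" and g: "g \<in> carrier FA"
  shows "lin_ext h (f \<otimes>\<^bsub>FA\<^esub> g) = lin_ext (\<lambda>u. lin_ext (\<lambda>v. h (u @ v)) g) f"
  using f
proof (induction rule: free_algebra_induct)
  case zero
  then show ?case using g by simp
next
  case (add k u f)
  have "lin_ext h (monomial u \<otimes>\<^bsub>FA\<^esub> g) = lin_ext (\<lambda>v. h (u @ v)) g"
    using g
  proof (induction rule: free_algebra_induct)
    case zero
    then show ?case using monomial_closed[OF add(3)] by simp
  next
    case (add l v g)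
    note [simp] = monomial_closed[OF add(3)] monomial_closed[OF \<open>u \<in> lists X - {[]}\<close>]
    have [simp]: "monomial (u @ v) \<in> carrier FA" using add(3) \<open>u \<in> lists X - {[]}\<close> by (intro monomial_closed) auto
    show ?case using add
      by (simp add: F.mult_r_distr F.smult_mult_r F.mult_closed monomial_mult)
  qed
  then show ?case
    using add g monomial_closed[OF add(3)]
    by (simp add: F.mult_l_distr F.smult_mult_l F.mult_closed)
qed

end

section \<open>Words in a Leavitt path algebra\<close>

locale leavitt = wf_digraph E + field K for E :: "('v, 'e) pre_digraph" and K (structure)

sublocale leavitt \<subseteq> free_nonunital K "lpa_generators E"
  by unfold_locales

context leavitt
begin

abbreviation I where "I \<equiv> leavitt_ideal K E"
abbreviation Q where "Q \<equiv> leavitt_path_algebra K E"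
abbreviation cls where "cls f \<equiv> I +>\<^bsub>FA\<^esub> f"
abbreviation wcls where "wcls w \<equiv> cls (monomial w)"
abbreviation words where "words \<equiv> lists (lpa_generators E) - {[]}"

lemma generator_iff [simp]:
  "Vertex v \<in> lpa_generators E \<longleftrightarrow> v \<in> verts E"
  "Edge e \<in> lpa_generators E \<longleftrightarrow> e \<in> arcs E"
  "Ghost e \<in> lpa_generators E \<longleftrightarrow> e \<in> arcs E"
  by (auto simp: lpa_generators_def)

sublocale Q: nonunital_algebra K Q
  by (rule leavitt_path_algebra_nonunital_algebra) unfold_locales

lemma zero_fun_eq: "(\<lambda>w. \<zero>) = \<zero>\<^bsub>FA\<^esub>"
  by (simp add: free_algebra_def)

lemma relations_closed:
  assumes "(a, b) \<in> lpa_relations K E"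
  shows "a \<in> carrier FA" "b \<in> carrier FA"
  using assms
  by (cases; auto intro!: monomial_closed F.M.finsum_closed simp: zero_fun_eq regular_vertices_def)+

lemma leavitt_ideal: "algebra_ideal K FA I"
  unfolding leavitt_ideal_def using relations_closed
  by (intro F.ideal_generated_by_ideal) auto

lemma leavitt_ideal_least:
  assumes "algebra_ideal K FA J"
    and "\<And>a b. (a, b) \<in> lpa_relations K E \<Longrightarrow> a \<ominus>\<^bsub>FA\<^esub> b \<in> J"
  shows "I \<subseteq> J"
  unfolding leavitt_ideal_def ideal_generated_by_def using assms by blast

lemma relation_in_ideal: "(a, b) \<in> lpa_relations K E \<Longrightarrow> a \<ominus>\<^bsub>FA\<^esub> b \<in> I"
  unfolding leavitt_ideal_def ideal_generated_by_def by blast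

lemma Q_carrier: "carrier Q = cls ` carrier FA"
  unfolding leavitt_path_algebra_def by (rule F.quotient_carrier[OF leavitt_ideal])

lemma Q_zero: "\<zero>\<^bsub>Q\<^esub> = cls \<zero>\<^bsub>FA\<^esub>"
  unfolding leavitt_path_algebra_def by (rule F.quotient_zero[OF leavitt_ideal])

lemma Q_add: "f \<in> carrier FA \<Longrightarrow> g \<in> carrier FA \<Longrightarrow> cls f \<oplus>\<^bsub>Q\<^esub> cls g = cls (f \<oplus>\<^bsub>FA\<^esub> g)"
  unfolding leavitt_path_algebra_def by (rule F.quotient_add[OF leavitt_ideal])

lemma Q_smult: "k \<in> carrier K \<Longrightarrow> f \<in> carrier FA \<Longrightarrow> k \<odot>\<^bsub>Q\<^esub> cls f = cls (k \<odot>\<^bsub>FA\<^esub> f)"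
  unfolding leavitt_path_algebra_def by (rule F.quotient_smult[OF leavitt_ideal])

lemma Q_mult: "f \<in> carrier FA \<Longrightarrow> g \<in> carrier FA \<Longrightarrow> cls f \<otimes>\<^bsub>Q\<^esub> cls g = cls (f \<otimes>\<^bsub>FA\<^esub> g)"
  unfolding leavitt_path_algebra_def by (rule F.quotient_mult[OF leavitt_ideal])

lemma cls_closed [simp]: "f \<in> carrier FA \<Longrightarrow> cls f \<in> carrier Q"
  by (simp add: Q_carrier)

lemma wcls_closed [simp]: "w \<in> words \<Longrightarrow> wcls w \<in> carrier Q"
  using monomial_closed by simp

lemma wcls_append: "u \<in> words \<Longrightarrow> v \<in> words \<Longrightarrow> wcls (u @ v) = wcls u \<otimes>\<^bsub>Q\<^esub> wcls v"
  using monomial_closed by (simp add: Q_mult monomial_mult)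

lemma relation_cls:
  assumes "(a, b) \<in> lpa_relations K E"
  shows "cls a = cls b"
proof (rule F.coset_eqI[OF leavitt_ideal relation_in_ideal[OF assms]])
  show "b \<in> carrier FA" using relations_closed[OF assms] by simp
  show "a = a \<ominus>\<^bsub>FA\<^esub> b \<oplus>\<^bsub>FA\<^esub> b"
    using relations_closed[OF assms] by (simp add: a_minus_def F.M.a_assoc F.M.l_neg)
qed

text \<open>The relation is multiplied on the right by the class of \<open>x\<close>. An empty
  \<open>x\<close> is treated apart, because the empty word gives no element of the non-unital free
  algebra.\<close>

lemma wcls_relation_append:
  assumes "(monomial u, monomial v) \<in> lpa_relations K E" "u \<in> words" "v \<in> words"
    "x \<in> lists (lpa_generators E)"
  shows "wcls (u @ x) = wcls (v @ x)"
  using relation_cls[OF assms(1)] wcls_append[of u x] wcls_append[of v x] assms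
  by (cases "x = []") auto

lemma wcls_zero_append:
  assumes "(monomial u, \<lambda>w. \<zero>) \<in> lpa_relations K E" "u \<in> words" "x \<in> lists (lpa_generators E)"
  shows "wcls (u @ x) = \<zero>\<^bsub>Q\<^esub>"
  using relation_cls[OF assms(1)] wcls_append[of u x] assms
  by (cases "x = []") (auto simp: zero_fun_eq Q_zero[symmetric])

lemma wcls_Cons: "g \<in> lpa_generators E \<Longrightarrow> w \<in> words \<Longrightarrow> wcls (g # w) = wcls [g] \<otimes>\<^bsub>Q\<^esub> wcls w"
  using wcls_append[of "[g]" w] by auto

text \<open>In this form the relations act as rewrite rules for the first two letters of a
  word.\<close>

lemma wcls_reduce:
  assumes "(monomial [g, h], monomial [k]) \<in> lpa_relations K E"
    "{g, h, k} \<subseteq> lpa_generators E" "x \<in> lists (lpa_generators E)"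
  shows "wcls (g # h # x) = wcls (k # x)"
  using wcls_relation_append[OF assms(1) _ _ assms(3)] assms(2) by simp

lemma wcls_reduce_zero:
  assumes "(monomial [g, h], \<lambda>w. \<zero>) \<in> lpa_relations K E"
    "{g, h} \<subseteq> lpa_generators E" "x \<in> lists (lpa_generators E)"
  shows "wcls (g # h # x) = \<zero>\<^bsub>Q\<^esub>"
  using wcls_zero_append[OF assms(1) _ assms(3)] assms(2) by simp

end

section \<open>Normal forms over a finite subgraph\<close>

locale finite_subgraph = leavitt E K for E :: "('v, 'e) pre_digraph" and K (structure) +
  fixes V :: "'v set" and F :: "'e set"
  assumes F: "finite F" "F \<subseteq> arcs E" and V: "finite V" "V \<subseteq> verts E"
    and tail_in: "e \<in> F \<Longrightarrow> tail E e \<in> V" and head_in: "e \<in> F \<Longrightarrow> head E e \<in> V"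
begin

definition subgens where "subgens = Vertex ` V \<union> Edge ` F \<union> Ghost ` F"

text \<open>The vertex in the middle keeps the word nonempty when both walks are trivial.\<close>

definition walk_word :: "'e list \<Rightarrow> 'v \<Rightarrow> 'e list \<Rightarrow> ('v, 'e) lpa_gen list" where
  "walk_word p v q = map Edge p @ Vertex v # map Ghost (rev q)"

text \<open>The words \<open>\<alpha>\<beta>\<^sup>*\<close>, where \<open>\<alpha>\<close> is a walk of the subgraph starting at \<open>u\<close>.\<close>

definition normal :: "'v \<Rightarrow> ('v, 'e) lpa_gen list set" where
  "normal u = {walk_word p v q | p v q. v \<in> V \<and> set p \<subseteq> F \<and> set q \<subseteq> F \<and> awalk u p v \<and>
     (\<exists>w. awalk w q v)}"

lemma subgens_iff [simp]:
  "Vertex v \<in> subgens \<longleftrightarrow> v \<in> V" "Edge e \<in> subgens \<longleftrightarrow> e \<in> F" "Ghost e \<in> subgens \<longleftrightarrow> e \<in> F"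
  by (auto simp: subgens_def)

lemma subgens_subset: "subgens \<subseteq> lpa_generators E"
  using F V by (auto simp: subgens_def)

lemma normalI:
  "\<lbrakk>v \<in> V; set p \<subseteq> F; set q \<subseteq> F; awalk u p v; awalk w q v\<rbrakk> \<Longrightarrow> walk_word p v q \<in> normal u"
  by (auto simp: normal_def)

lemma normal_words: "n \<in> normal u \<Longrightarrow> n \<in> lists subgens - {[]}"
  by (auto simp: normal_def walk_word_def subset_iff)

lemma normal_in_words: "n \<in> normal u \<Longrightarrow> n \<in> words"
  using normal_words[of n u] subgens_subset lists_mono by blast

text \<open>A generator multiplied from the left meets only the front of a normal word: a vertex
  followed by ghosts if \<open>\<alpha>\<close> is trivial, and otherwise an arc followed by a
  shorter normal word.\<close>

lemma normal_cases [consumes 1, case_names vertex edge]: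
  assumes "n \<in> normal u"
  obtains q w where "u \<in> V" "set q \<subseteq> F" "awalk w q u" "n = Vertex u # map Ghost (rev q)"
  | e m where "e \<in> F" "u = tail E e" "m \<in> normal (head E e)" "n = Edge e # m"
proof -
  obtain p v q w where n: "n = walk_word p v q" "v \<in> V" "set p \<subseteq> F" "set q \<subseteq> F"
      "awalk u p v" "awalk w q v"
    using assms by (auto simp: normal_def)
  show ?thesis
  proof (cases p)
    case Nil
    then show ?thesis using n that(1) by (auto simp: walk_word_def awalk_Nil_iff)
  next
    case (Cons e p')
    have "walk_word p' v q \<in> normal (head E e)"
      using n Cons by (intro normalI[where w = w]) (simp_all add: awalk_Cons_iff)
    moreover have "n = Edge e # walk_word p' v q" using n(1) Cons by (simp add: walk_word_def)
    ultimately show ?thesis using n Cons by (intro that(2)) (simp_all add: awalk_Cons_iff)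
  qed
qed

lemma normal_Edge:
  assumes "e \<in> F" "n \<in> normal (head E e)"
  shows "Edge e # n \<in> normal (tail E e)"
proof -
  obtain p v q w where n: "n = walk_word p v q" "v \<in> V" "set p \<subseteq> F" "set q \<subseteq> F"
      "awalk (head E e) p v" "awalk w q v"
    using assms by (auto simp: normal_def)
  then have "walk_word (e # p) v q \<in> normal (tail E e)"
    using assms(1) F by (intro normalI) (auto simp: awalk_Cons_iff)
  then show ?thesis by (simp add: walk_word_def n)
qed

text \<open>The class of \<open>n\<close> absorbs \<open>Vertex u\<close> on the left, so
  \<open>Vertex x\<close> meets \<open>Vertex u\<close>, and vertices are orthogonal
  idempotents.\<close>

lemma Vertex_normal:
  assumes x: "x \<in> V" and n: "n \<in> normal u"
  shows "wcls (Vertex x # n) = (if x = u then wcls n else \<zero>\<^bsub>Q\<^esub>)"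
proof -
  have [simp]: "x \<in> verts E" using x V by auto
  have *: "wcls (Vertex x # Vertex u # m) = (if x = u then wcls (Vertex u # m) else \<zero>\<^bsub>Q\<^esub>)"
    if "u \<in> verts E" "m \<in> lists (lpa_generators E)" for m
    using that wcls_reduce[OF vertex_idem] wcls_reduce_zero[OF vertex_orth] by simp
  from n show ?thesis
  proof (cases rule: normal_cases)
    case (vertex q w)
    have "map Ghost (rev q) \<in> lists (lpa_generators E)" using subset_trans[OF vertex(2) F(2)] by (auto simp: subset_iff)
    then show ?thesis using *[of "map Ghost (rev q)"] vertex(1,4) V by auto
  next
    case (edge e m)
    have m: "m \<in> lists (lpa_generators E)" and e: "e \<in> arcs E"
      using normal_in_words[OF edge(3)] edge(1) F by auto
    have u: "u \<in> verts E" using edge(2) e by simp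
    have src: "wcls (Vertex u # n) = wcls n"
      using wcls_reduce[OF source_edge[OF e] _ m] e by (simp add: edge)
    have nw: "n \<in> words" using normal_in_words[OF n] .
    \<comment> \<open>The rewrite rules act only at the front of a word, so \<open>Vertex x\<close>
      is split off as a factor while \<open>Vertex u\<close> is inserted behind it.\<close>
    have "wcls (Vertex x # n) = wcls [Vertex x] \<otimes>\<^bsub>Q\<^esub> wcls (Vertex u # n)"
      using wcls_Cons[of "Vertex x" n] nw src by simp
    also have "\<dots> = wcls (Vertex x # Vertex u # n)"
      using nw u by (intro wcls_Cons[symmetric]) simp_all
    finally show ?thesis using *[of n] u nw src by simp
  qed
qed

text \<open>Inserting \<open>Vertex (head E e)\<close> between the arc and \<open>n\<close> reduces
  this to \<open>Vertex_normal\<close>. The content is the vanishing in the second branch.\<close>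

lemma Edge_normal:
  assumes e: "e \<in> F" and n: "n \<in> normal u"
  shows "wcls (Edge e # n) = (if head E e = u then wcls (Edge e # n) else \<zero>\<^bsub>Q\<^esub>)"
proof -
  have ea: "e \<in> arcs E" and nw: "n \<in> words" using e F normal_in_words[OF n] by auto
  have "wcls (Edge e # n) = wcls (Edge e # Vertex (head E e) # n)"
    using wcls_reduce[OF edge_range[OF ea], of n] ea nw by simp
  also have "\<dots> = wcls [Edge e] \<otimes>\<^bsub>Q\<^esub> wcls (Vertex (head E e) # n)"
    using ea nw by (intro wcls_Cons) simp_all
  finally show ?thesis using Vertex_normal[OF head_in[OF e] n] ea by simp
qed

text \<open>The start vertex of the normal word is left open, since generators multiplied on the
  left may move it.\<close>

definition reducible :: "('v, 'e) lpa_gen list \<Rightarrow> bool" where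
  "reducible w \<longleftrightarrow> wcls w = \<zero>\<^bsub>Q\<^esub> \<or> (\<exists>u. \<exists>n\<in>normal u. wcls w = wcls n)"

lemma reducibleI: "n \<in> normal u \<Longrightarrow> wcls w = wcls n \<Longrightarrow> reducible w"
  unfolding reducible_def by blast

lemma reducible_zero: "wcls w = \<zero>\<^bsub>Q\<^esub> \<Longrightarrow> reducible w"
  unfolding reducible_def by simp

text \<open>Against a leading arc the ghost cancels or gives zero. If \<open>\<alpha>\<close> is
  trivial, the ghost is either absorbed into \<open>\<beta>\<^sup>*\<close> or annihilated by the
  vertex.\<close>

lemma Ghost_normal:
  assumes e: "e \<in> F" and n: "n \<in> normal u"
  shows "reducible (Ghost e # n)"
proof -
  have ea: "e \<in> arcs E" using e F by auto
  have nw: "n \<in> words" using normal_in_words[OF n] .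
  from n show ?thesis
  proof (cases rule: normal_cases)
    case (edge f m)
    have m: "m \<in> lists (lpa_generators E)" and f: "f \<in> arcs E"
      using normal_in_words[OF edge(3)] edge(1) F by auto
    show ?thesis
    proof (cases "e = f")
      case True
      then have "wcls (Ghost e # n) = wcls (Vertex (head E e) # m)"
        using wcls_reduce[OF ghost_edge_same[OF ea] _ m] ea by (simp add: edge(4))
      also have "\<dots> = wcls m"
        using Vertex_normal[OF head_in[OF e] edge(3)] True by simp
      finally show ?thesis by (rule reducibleI[OF edge(3)])
    next
      case False
      then show ?thesis
        using wcls_reduce_zero[OF ghost_edge_diff[OF ea f False] _ m] ea f
        by (intro reducible_zero) (simp add: edge(4))
    qed
  next
    case (vertex q w)
    let ?q = "map Ghost (rev q)"
    have q: "?q \<in> lists (lpa_generators E)" using subset_trans[OF vertex(2) F(2)] by (auto simp: subset_iff)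
    have "wcls (Ghost e # n) = wcls (Ghost e # Vertex (tail E e) # n)"
      using wcls_reduce[OF ghost_source[OF ea], of n] ea nw by simp
    also have "\<dots> = wcls [Ghost e] \<otimes>\<^bsub>Q\<^esub> wcls (Vertex (tail E e) # n)"
      using ea nw by (intro wcls_Cons) simp_all
    finally have *: "wcls (Ghost e # n) = wcls [Ghost e] \<otimes>\<^bsub>Q\<^esub> (if tail E e = u then wcls n else \<zero>\<^bsub>Q\<^esub>)"
      using Vertex_normal[OF tail_in[OF e] n] by simp
    show ?thesis
    proof (cases "tail E e = u")
      case True
      have "wcls (Ghost e # n) = wcls (Ghost e # ?q)"
        using wcls_reduce[OF ghost_source[OF ea] _ q] ea True tail_in_verts[OF ea]
        by (simp add: vertex(4))
      also have "\<dots> = wcls (Vertex (head E e) # Ghost e # ?q)"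
        using wcls_reduce[OF range_ghost[OF ea] _ q] ea by simp
      \<comment> \<open>Since ghosts are listed in reverse, a ghost put in front lengthens the walk
        \<open>q\<close> at its end, and the middle vertex moves to \<open>head E e\<close>.\<close>
      also have "Vertex (head E e) # Ghost e # ?q = walk_word [] (head E e) (q @ [e])"
        by (simp add: walk_word_def)
      finally have eq: "wcls (Ghost e # n) = wcls (walk_word [] (head E e) (q @ [e]))" .
      have "walk_word [] (head E e) (q @ [e]) \<in> normal (head E e)"
        using vertex(2,3) e True ea head_in[OF e]
        by (intro normalI[where w = w]) (simp_all add: awalk_Nil_iff awalk_Cons_iff)
      then show ?thesis using eq by (rule reducibleI)
    next
      case False
      then show ?thesis using * ea by (intro reducible_zero) simp
    qed
  qed
qed

lemma generator_normal:
  assumes g: "g \<in> subgens" and n: "n \<in> normal u"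
  shows "reducible (g # n)"
proof -
  consider x where "x \<in> V" "g = Vertex x" | e where "e \<in> F" "g = Edge e"
    | e where "e \<in> F" "g = Ghost e"
    using g by (auto simp: subgens_def)
  then show ?thesis
  proof cases
    case (1 x)
    then show ?thesis
      using Vertex_normal[OF 1(1) n] reducibleI[OF n] reducible_zero by (cases "x = u") simp_all
  next
    case (2 e)
    show ?thesis
    proof (cases "head E e = u")
      case True
      then show ?thesis using reducibleI[OF normal_Edge[OF 2(1)]] n 2(2) by simp
    next
      case False
      then show ?thesis using Edge_normal[OF 2(1) n] 2(2) by (simp add: reducible_zero)
    qed
  next
    case (3 e)
    then show ?thesis using Ghost_normal n by simp
  qed
qed

text \<open>The word is built up from its right end, each time multiplying a normal word by one
  generator on the left.\<close>

lemma subgens_word_reducible: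
  assumes "w \<in> lists subgens - {[]}"
  shows "reducible w"
  using assms
proof (induction w)
  case (Cons g w)
  then have g: "g \<in> subgens" "g \<in> lpa_generators E" using subgens_subset by auto
  show ?case
  proof (cases "w = []")
    case True
    have v: "[Vertex v] \<in> normal v" if "v \<in> V" for v
    proof -
      have "awalk v [] v" using that V by (auto simp: awalk_Nil_iff)
      then show ?thesis using normalI[of v "[]" "[]" v v] that by (simp add: walk_word_def)
    qed
    \<comment> \<open>A single arc or ghost equals its product with a vertex on the right, and that
      vertex is the normal word of two trivial walks.\<close>
    have transfer: "reducible (g # w)" if "wcls (g # w) = wcls (g # n)" "n \<in> normal u" for n u
      using generator_normal[OF g(1) that(2)] that(1) by (simp add: reducible_def)
    consider x where "x \<in> V" "g = Vertex x" | e where "e \<in> F" "g = Edge e"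
      | e where "e \<in> F" "g = Ghost e"
      using g by (auto simp: subgens_def)
    then show ?thesis
    proof cases
      case (1 x)
      then show ?thesis using reducibleI[OF v[OF 1(1)]] True by simp
    next
      case (2 e)
      then have "wcls (g # w) = wcls (g # [Vertex (head E e)])"
        using relation_cls[OF edge_range, of e] F True by auto
      then show ?thesis using transfer v[OF head_in[OF 2(1)]] by blast
    next
      case (3 e)
      then have "wcls (g # w) = wcls (g # [Vertex (tail E e)])"
        using relation_cls[OF ghost_source, of e] F True by auto
      then show ?thesis using transfer v[OF tail_in[OF 3(1)]] by blast
    qed
  next
    case False
    then have w: "w \<in> lists subgens - {[]}" using Cons.prems by simp
    then have "w \<in> words" using lists_mono[OF subgens_subset] by auto
    then have eq: "wcls (g # w) = wcls [g] \<otimes>\<^bsub>Q\<^esub> wcls w" using g by (intro wcls_Cons)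
    from Cons.IH[OF w] consider "wcls w = \<zero>\<^bsub>Q\<^esub>" | u n where "n \<in> normal u" "wcls w = wcls n"
      unfolding reducible_def by blast
    then show ?thesis
    proof cases
      case 1
      then show ?thesis using eq g by (intro reducible_zero) simp
    next
      case (2 u n)
      then have "wcls (g # w) = wcls (g # n)"
        using eq wcls_Cons[OF g(2) normal_in_words[OF 2(1)]] by simp
      then show ?thesis using generator_normal[OF g(1) 2(1)] by (simp add: reducible_def)
    qed
  qed
qed simp

text \<open>Here acyclicity enters: between two occurrences of an arc a walk would close up, so its
  arcs are distinct and its length is at most \<open>card F\<close>.\<close>

lemma finite_normal:
  assumes "acyclic_digraph E"
  shows "finite (\<Union>u. normal u)"
proof -
  have dist: "distinct p" if "awalk u p v" for u p v
  proof (rule ccontr)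
    assume "\<not> distinct p"
    then obtain e xs ys zs where "p = xs @ [e] @ ys @ [e] @ zs"
      using not_distinct_decomp by blast
    then have "awalk (tail E e) (e # ys) (tail E e)"
      using that by (auto simp: awalk_Cons_iff)
    then show False using assms by (auto simp: acyclic_digraph_def)
  qed
  let ?P = "{p. set p \<subseteq> F \<and> length p \<le> card F}"
  have P: "p \<in> ?P" if "awalk u p v" "set p \<subseteq> F" for u p v
    using that dist[OF that(1)] F by (auto simp: distinct_card[symmetric] intro!: card_mono)
  have "(\<Union>u. normal u) \<subseteq> (\<lambda>(p, v, q). walk_word p v q) ` (?P \<times> V \<times> ?P)"
  proof
    fix n assume "n \<in> (\<Union>u. normal u)"
    then obtain u p v q w where n: "n = walk_word p v q" "v \<in> V" "set p \<subseteq> F" "set q \<subseteq> F"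
        "awalk u p v" "awalk w q v"
      by (auto simp: normal_def)
    then have "(p, v, q) \<in> ?P \<times> V \<times> ?P" using P by blast
    then show "n \<in> (\<lambda>(p, v, q). walk_word p v q) ` (?P \<times> V \<times> ?P)" using n(1) by force
  qed
  moreover have "finite (?P \<times> V \<times> ?P)"
    using F V by (intro finite_cartesian_product finite_lists_length_le)
  ultimately show ?thesis using finite_subset by blast
qed

text \<open>The product of two normal words is a word in \<open>subgens\<close>, which reduces to
  zero or to a normal word; hence the span is closed under multiplication.\<close>

lemma normal_span:
  assumes "acyclic_digraph E"
  defines "B \<equiv> lin_span K Q (wcls ` (\<Union>u. normal u))"
  shows "subalgebra_of K Q B" "finite_dim K Q B"
    "\<And>w. w \<in> lists subgens - {[]} \<Longrightarrow> wcls w \<in> B"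
proof -
  let ?N = "wcls ` (\<Union>u. normal u)"
  have N: "?N \<subseteq> carrier Q" using normal_in_words by auto
  have B: "submodule B K Q" "?N \<subseteq> B"
    unfolding B_def using Q.lin_span_submodule[OF N] Q.lin_span_superset[OF N] by auto
  show w: "wcls w \<in> B" if "w \<in> lists subgens - {[]}" for w
    using subgens_word_reducible[OF that] Q.submodule_zero[OF B(1)] B(2)
    by (auto simp: reducible_def)
  show "subalgebra_of K Q B" unfolding B_def
  proof (rule Q.lin_span_subalgebra[OF N])
    fix s t assume "s \<in> ?N" "t \<in> ?N"
    then obtain a b m n where st: "m \<in> normal a" "n \<in> normal b" "s = wcls m" "t = wcls n"
      by (elim imageE UN_E)
    then have "s \<otimes>\<^bsub>Q\<^esub> t = wcls (m @ n)"
      using wcls_append[OF normal_in_words[OF st(1)] normal_in_words[OF st(2)]] by simp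
    moreover have "m @ n \<in> lists subgens - {[]}"
      using normal_words[OF st(1)] normal_words[OF st(2)] by auto
    ultimately show "s \<otimes>\<^bsub>Q\<^esub> t \<in> lin_span K Q ?N" using w by (simp add: B_def)
  qed
  show "finite_dim K Q B"
    unfolding finite_dim_def using finite_normal[OF assms(1)] B(2)
    by (intro exI[of _ ?N]) (simp add: B_def)
qed

end

section \<open>From acyclicity to local finiteness\<close>

context leavitt
begin

lemma acyclic_imp_locally_finite:
  assumes acyclic: "acyclic_digraph E"
  shows "locally_finite_algebra K Q"
  unfolding locally_finite_algebra_def
proof (intro allI impI, elim conjE)
  fix S assume S: "finite S" "S \<subseteq> carrier Q"
  then have "\<forall>s\<in>S. \<exists>f. f \<in> carrier FA \<and> s = cls f" unfolding Q_carrier by blast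
  from bchoice[OF this] obtain r where r: "r s \<in> carrier FA" "s = cls (r s)" if "s \<in> S" for s
    by blast
  \<comment> \<open>These are the finitely many letters occurring in the chosen representatives of
    \<open>S\<close>.\<close>
  define L where "L = (\<Union>s\<in>S. \<Union>w\<in>{w. r s w \<noteq> \<zero>}. set w)"
  have L: "finite L" "L \<subseteq> lpa_generators E"
    using S r(1) finite_support support_words unfolding L_def by fastforce+
  define F where "F = Edge -` L \<union> Ghost -` L"
  \<comment> \<open>The ends of all chosen arcs are added, as \<open>finite_subgraph\<close>
    demands.\<close>
  define V where "V = Vertex -` L \<union> tail E ` F \<union> head E ` F"
  have F: "finite F" "F \<subseteq> arcs E" and V: "finite V" "V \<subseteq> verts E"
    using L unfolding F_def V_def by (auto intro!: finite_vimageI injI)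
  interpret finite_subgraph E K V F
    using F V by unfold_locales (auto simp: V_def)
  note B = normal_span[OF acyclic]
  let ?B = "lin_span K Q (wcls ` (\<Union>u. normal u))"
  have L_sub: "L \<subseteq> subgens"
  proof
    fix g assume "g \<in> L"
    moreover have "Vertex v \<in> L \<Longrightarrow> v \<in> V" "Edge e \<in> L \<Longrightarrow> e \<in> F" "Ghost e \<in> L \<Longrightarrow> e \<in> F" for v e
      by (simp_all add: V_def F_def)
    ultimately show "g \<in> subgens" by (cases g) simp_all
  qed
  have Bm: "submodule ?B K Q" using B(1) by (simp add: subalgebra_of_def)
  \<comment> \<open>Membership in the span is pulled back to the free algebra, where it can be
    tested on the monomials of a representative.\<close>
  have U: "submodule {f \<in> carrier FA. cls f \<in> ?B} K FA"
    using Q.submodule_zero[OF Bm] Q.submoduleE(4,5)[OF Bm]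
    by (intro F.submodule_criterion) (auto simp: Q_zero Q_add[symmetric] Q_smult[symmetric])
  have "s \<in> ?B" if s: "s \<in> S" for s
  proof -
    have "r s \<in> {f \<in> carrier FA. cls f \<in> ?B}"
    proof (rule in_submoduleI[OF U r(1)[OF s]])
      fix w assume w: "r s w \<noteq> \<zero>"
      then have "w \<in> words" using support_words[OF r(1)[OF s]] by simp
      moreover have "w \<in> lists subgens - {[]}"
        using w s \<open>w \<in> words\<close> L_sub by (auto simp: L_def)
      ultimately show "monomial w \<in> {f \<in> carrier FA. cls f \<in> ?B}"
        using B(3) monomial_closed by simp
    qed
    then show ?thesis using r(2)[OF s] by simp
  qed
  then show "\<exists>B. subalgebra_of K Q B \<and> finite_dim K Q B \<and> S \<subseteq> B" using B(1,2) by blast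
qed

end

section \<open>An action by partial injections\<close>

context leavitt
begin

text \<open>
  The points \<open>(v, d, y)\<close> carry a right action of the generators by partial injections. The arcs
  leaving \<open>v\<close> embed the set of all \<open>y\<close> into itself with disjoint images (\<open>shift\<close>), and these images
  cover it when \<open>v\<close> is regular: there the \<open>k\<close> component is split into residue classes.
  The integer \<open>d\<close> turns the degree of a word into a displacement.
\<close>

definition arc_index :: "'v \<Rightarrow> 'e \<Rightarrow> nat" where
  "arc_index v = (SOME h. bij_betw h (out_arcs E v) {0..<card (out_arcs E v)})"

definition shift :: "'e \<Rightarrow> nat \<times> 'e list \<Rightarrow> nat \<times> 'e list" where
  "shift e = (\<lambda>(k, l). if tail E e \<in> regular_vertices E
     then (card (out_arcs E (tail E e)) * k + arc_index (tail E e) e, l) else (k, e # l))"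

lemma arc_index_bij:
  "v \<in> regular_vertices E \<Longrightarrow> bij_betw (arc_index v) (out_arcs E v) {0..<card (out_arcs E v)}"
  unfolding arc_index_def
  using someI_ex[OF ex_bij_betw_finite_nat, of "out_arcs E v"]
  by (simp add: regular_vertices_def)

text \<open>Over a regular vertex this is uniqueness of division with remainder, the remainder being
  the index of the arc; elsewhere the arc can be read off as the head of the list.\<close>

lemma shift_eq_iff:
  assumes e: "e \<in> arcs E" and f: "f \<in> arcs E" and tail: "tail E e = tail E f"
  shows "shift e x = shift f y \<longleftrightarrow> e = f \<and> x = y"
proof (cases "tail E f \<in> regular_vertices E")
  case True
  let ?n = "card (out_arcs E (tail E f))" and ?i = "arc_index (tail E f)"
  have bij: "bij_betw ?i (out_arcs E (tail E f)) {0..<?n}" using True by (rule arc_index_bij)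
  have mem: "e \<in> out_arcs E (tail E f)" "f \<in> out_arcs E (tail E f)" using e f tail by auto
  then have lt: "?i e < ?n" "?i f < ?n" using bij_betwE[OF bij] by auto
  have "e = f \<and> k = m" if "?n * k + ?i e = ?n * m + ?i f" for k m
  proof -
    have "(?n * k + ?i e) mod ?n = (?n * m + ?i f) mod ?n" using that by simp
    then have "?i e = ?i f" using lt by simp
    moreover from this have "k = m" using that lt by simp
    ultimately show ?thesis using bij mem by (auto simp: bij_betw_def inj_on_def)
  qed
  then have "?n * k + ?i e = ?n * m + ?i f \<longleftrightarrow> e = f \<and> k = m" for k m by blast
  then show ?thesis using True tail by (simp add: shift_def split: prod.split)
next
  case False
  then show ?thesis using tail by (simp add: shift_def conj_ac split: prod.split)
qed

text \<open>This is existence of division with remainder: the remainder of the number selects the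
  arc. It makes the relation at regular vertices hold.\<close>

lemma shift_cover:
  assumes "v \<in> regular_vertices E"
  shows "\<exists>e\<in>out_arcs E v. \<exists>y. x = shift e y"
proof -
  obtain k l where x: "x = (k, l)" by (cases x)
  let ?n = "card (out_arcs E v)"
  have bij: "bij_betw (arc_index v) (out_arcs E v) {0..<?n}" using assms by (rule arc_index_bij)
  have "?n > 0" using assms by (auto simp: regular_vertices_def card_gt_0_iff)
  then have "k mod ?n \<in> arc_index v ` out_arcs E v"
    using bij by (simp add: bij_betw_def)
  then obtain e where e: "e \<in> out_arcs E v" "arc_index v e = k mod ?n" by auto
  then have "x = shift e (k div ?n, l)"
    using assms x by (simp add: shift_def)
  then show ?thesis using e(1) by blast
qed

fun act :: "('v, 'e) lpa_gen \<Rightarrow> 'v \<times> int \<times> nat \<times> 'e list \<Rightarrow> ('v \<times> int \<times> nat \<times> 'e list) option" where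
  "act (Vertex v) (u, d, y) = (if u = v then Some (u, d, y) else None)"
| "act (Ghost e) (u, d, y) = (if u = head E e then Some (tail E e, d + 1, shift e y) else None)"
| "act (Edge e) (u, d, y) = (if u = tail E e \<and> y \<in> range (shift e)
     then Some (head E e, d - 1, the_inv (shift e) y) else None)"

text \<open>The first letter acts first, as befits a right action; \<open>None\<close> plays the
  role of zero and is absorbing.\<close>

definition run where
  "run w r = fold (\<lambda>g r. Option.bind r (act g)) w r"

lemma run_simps [simp]:
  "run [] r = r" "run (g # w) r = run w (Option.bind r (act g))"
  by (simp_all add: run_def)

lemma run_append [simp]: "run (u @ v) r = run v (run u r)"
  by (simp add: run_def)

lemma run_None [simp]: "run w None = None"
  by (induction w) auto

lemma the_inv_shift [simp]: "e \<in> arcs E \<Longrightarrow> the_inv (shift e) (shift e y) = y"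
  using shift_eq_iff[of e e] by (simp add: the_inv_f_f inj_def)

lemma shift_in_range:
  "\<lbrakk>e \<in> arcs E; f \<in> arcs E; tail E e = tail E f\<rbrakk> \<Longrightarrow> shift e y \<in> range (shift f) \<longleftrightarrow> e = f"
  by (simp add: image_iff shift_eq_iff)

section \<open>Functionals that detect the action\<close>

definition test_function :: "(('v \<times> int \<times> nat \<times> 'e list) option \<Rightarrow> 'a) \<Rightarrow> bool" where
  "test_function \<phi> \<longleftrightarrow> \<phi> None = \<zero> \<and> (\<forall>r. \<phi> r \<in> carrier K)"

lemma test_function_closed [simp]: "test_function \<phi> \<Longrightarrow> \<phi> r \<in> carrier K"
  by (simp add: test_function_def)

lemma test_function_None [simp]: "test_function \<phi> \<Longrightarrow> \<phi> None = \<zero>"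
  by (simp add: test_function_def)

text \<open>On the vector space with the points as basis and \<open>None\<close> as zero vector, a
  test function is a linear functional; this is its value at \<open>r\<close> acted on by
  \<open>f\<close>.\<close>

definition pairing where
  "pairing \<phi> r f = lin_ext (\<lambda>w. \<phi> (run w r)) f"

text \<open>
  The relations hold for the action, so \<open>pairing \<phi> r\<close> descends to the Leavitt path algebra.
\<close>

definition annihilator where
  "annihilator = {f \<in> carrier FA. \<forall>\<phi> r. test_function \<phi> \<longrightarrow> pairing \<phi> r f = \<zero>}"

lemma lin_ext_zero_fun: "f \<in> carrier FA \<Longrightarrow> lin_ext (\<lambda>w. \<zero>) f = \<zero>"
  by (rule lin_ext_eq_zeroI) simp_all

text \<open>A product acts by \<open>f\<close> first and \<open>g\<close> second, so
  \<open>g\<close> can be moved into the functional.\<close>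

lemma pairing_mult:
  assumes "test_function \<phi>" "f \<in> carrier FA" "g \<in> carrier FA"
  shows "pairing \<phi> r (f \<otimes>\<^bsub>FA\<^esub> g) = pairing (\<lambda>s. pairing \<phi> s g) r f"
  using assms by (simp add: pairing_def lin_ext_mult)

lemma test_function_pairing:
  assumes "test_function \<phi>" "g \<in> carrier FA"
  shows "test_function (\<lambda>s. pairing \<phi> s g)"
proof -
  have "pairing \<phi> s g \<in> carrier K" for s using assms by (simp add: pairing_def)
  moreover have "pairing \<phi> None g = \<zero>" using assms by (simp add: pairing_def lin_ext_zero_fun)
  ultimately show ?thesis by (simp add: test_function_def)
qed

text \<open>By \<open>pairing_mult\<close>, left multiplication uses that all points
  \<open>r\<close> are allowed in \<open>annihilator\<close>, and right multiplication that all test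
  functions are.\<close>

lemma annihilator_ideal: "algebra_ideal K FA annihilator"
  unfolding algebra_ideal_def
proof (intro conjI ballI)
  show "submodule annihilator K FA"
    by (rule F.submodule_criterion) (auto simp: annihilator_def pairing_def)
  fix a x assume a: "a \<in> carrier FA" and x: "x \<in> annihilator"
  then have xc: "x \<in> carrier FA" by (simp add: annihilator_def)
  have "pairing \<phi> r (a \<otimes>\<^bsub>FA\<^esub> x) = \<zero>" if "test_function \<phi>" for \<phi> r
  proof -
    have "(\<lambda>s. pairing \<phi> s x) = (\<lambda>s. \<zero>)" using x that by (auto simp: annihilator_def)
    then have "pairing \<phi> r (a \<otimes>\<^bsub>FA\<^esub> x) = pairing (\<lambda>s. \<zero>) r a"
      using pairing_mult[OF that a xc] by simp
    then show ?thesis using a by (simp add: pairing_def lin_ext_zero_fun)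
  qed
  then show "a \<otimes>\<^bsub>FA\<^esub> x \<in> annihilator" using a xc by (simp add: annihilator_def F.mult_closed)
  have "pairing \<phi> r (x \<otimes>\<^bsub>FA\<^esub> a) = \<zero>" if "test_function \<phi>" for \<phi> r
    using x pairing_mult[OF that xc a] test_function_pairing[OF that a]
    by (simp add: annihilator_def)
  then show "x \<otimes>\<^bsub>FA\<^esub> a \<in> annihilator" using a xc by (simp add: annihilator_def F.mult_closed)
qed

lemma pairing_monomial: "test_function \<phi> \<Longrightarrow> pairing \<phi> r (monomial w) = \<phi> (run w r)"
  by (simp add: pairing_def)

text \<open>Over \<open>v\<close> only the arc \<open>f\<close> whose image contains
  \<open>y\<close> contributes: \<open>Edge f\<close> strips the shift and \<open>Ghost f\<close>
  restores it. Away from \<open>v\<close> every term is zero.\<close>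

lemma pairing_regular_vertex:
  assumes \<phi>: "test_function \<phi>" and v: "v \<in> regular_vertices E"
  shows "pairing \<phi> r (\<Oplus>\<^bsub>FA\<^esub>e\<in>out_arcs E v. monomial [Edge e, Ghost e]) = \<phi> (run [Vertex v] r)"
proof -
  have fin: "finite (out_arcs E v)" using v by (simp add: regular_vertices_def)
  have "pairing \<phi> r (\<Oplus>\<^bsub>FA\<^esub>e\<in>out_arcs E v. monomial [Edge e, Ghost e])
      = (\<Oplus>e\<in>out_arcs E v. pairing \<phi> r (monomial [Edge e, Ghost e]))"
    unfolding pairing_def using \<phi> by (intro lin_ext_finsum) (auto intro!: monomial_closed)
  also have "\<dots> = (\<Oplus>e\<in>out_arcs E v. \<phi> (run [Edge e, Ghost e] r))"
    using \<phi> by (simp add: pairing_monomial)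
  also have "\<dots> = \<phi> (run [Vertex v] r)"
  proof (cases "\<exists>d y. r = Some (v, d, y)")
    case True
    then obtain d y where r: "r = Some (v, d, y)" by blast
    obtain f z where f: "f \<in> out_arcs E v" "y = shift f z" using shift_cover[OF v, of y] by blast
    have "\<phi> (run [Edge e, Ghost e] r) = (if e = f then \<phi> (run [Vertex v] r) else \<zero>)"
      if "e \<in> out_arcs E v" for e
    proof -
      have "y \<in> range (shift e) \<longleftrightarrow> e = f" using that f shift_in_range[of f e z] by auto
      then show ?thesis using that f \<phi> by (auto simp: r)
    qed
    then have "(\<Oplus>e\<in>out_arcs E v. \<phi> (run [Edge e, Ghost e] r))
        = (\<Oplus>e\<in>out_arcs E v. if e = f then \<phi> (run [Vertex v] r) else \<zero>)"
      using \<phi> by (intro finsum_cong') auto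
    also have "\<dots> = \<phi> (run [Vertex v] r)"
      using \<phi> f(1) fin by (intro add.finprod_singleton_swap) auto
    finally show ?thesis .
  next
    case False
    have "\<phi> (run [Edge e, Ghost e] r) = \<zero>" if "e \<in> out_arcs E v" for e
      using that False \<phi> by (cases r) auto
    moreover have "run [Vertex v] r = None" using False by (cases r) auto
    ultimately show ?thesis using \<phi> by (auto intro!: add.finprod_one_eqI)
  qed
  finally show ?thesis .
qed

lemma pairing_relation:
  assumes \<phi>: "test_function \<phi>" and rel: "(a, b) \<in> lpa_relations K E"
  shows "pairing \<phi> r a = pairing \<phi> r b"
proof -
  have eq: "pairing \<phi> r (monomial v) = pairing \<phi> r (monomial w)"
    if "\<And>u d y. run v (Some (u, d, y)) = run w (Some (u, d, y))" for v w
    using that by (cases r) (auto simp: pairing_monomial[OF \<phi>])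
  have eq_zero: "pairing \<phi> r (monomial v) = pairing \<phi> r (\<lambda>w. \<zero>)"
    if "\<And>u d y. run v (Some (u, d, y)) = None" for v
  proof -
    have "run v r = None" using that by (cases r) auto
    then show ?thesis using \<phi> by (simp add: pairing_monomial[OF \<phi>] zero_fun_eq) (simp add: pairing_def)
  qed
  from rel show ?thesis
  proof cases
    case (vertex_idem v)
    show ?thesis unfolding vertex_idem(1,2) by (rule eq) simp
  next
    case (vertex_orth v v')
    show ?thesis unfolding vertex_orth(1,2) by (rule eq_zero) (use vertex_orth(5) in simp)
  next
    case (source_edge e)
    show ?thesis unfolding source_edge(1,2) by (rule eq) simp
  next
    case (edge_range e)
    show ?thesis unfolding edge_range(1,2) by (rule eq) simp
  next
    case (range_ghost e)
    show ?thesis unfolding range_ghost(1,2) by (rule eq) simp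
  next
    case (ghost_source e)
    show ?thesis unfolding ghost_source(1,2) by (rule eq) simp
  next
    case (ghost_edge_same e)
    show ?thesis unfolding ghost_edge_same(1,2) by (rule eq) (use ghost_edge_same(3) in simp)
  next
    case (ghost_edge_diff e f)
    \<comment> \<open>Distinct arcs with a common source have disjoint images; if the sources
      differ, the vertices already disagree.\<close>
    have "shift e y \<notin> range (shift f)" if "tail E e = tail E f" for y
      using shift_in_range[of e f y] ghost_edge_diff(3-5) that by simp
    then show ?thesis unfolding ghost_edge_diff(1,2)
      by (intro eq_zero, cases "tail E e = tail E f") simp_all
  next
    case (regular_vertex v)
    show ?thesis
      unfolding regular_vertex(1,2) pairing_monomial[OF \<phi>] pairing_regular_vertex[OF \<phi> regular_vertex(3)] ..
  qed
qed

lemma leavitt_ideal_annihilator: "I \<subseteq> annihilator"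
proof (rule leavitt_ideal_least[OF annihilator_ideal])
  fix a b assume rel: "(a, b) \<in> lpa_relations K E"
  note c = relations_closed[OF rel]
  have "pairing \<phi> r (a \<ominus>\<^bsub>FA\<^esub> b) = \<zero>" if \<phi>: "test_function \<phi>" for \<phi> r
  proof -
    have "pairing \<phi> r (a \<ominus>\<^bsub>FA\<^esub> b) = pairing \<phi> r a \<ominus> pairing \<phi> r b"
      using c \<phi> unfolding pairing_def by (intro lin_ext_minus) simp_all
    also have "\<dots> = pairing \<phi> r b \<oplus> \<ominus> pairing \<phi> r b"
      by (simp only: pairing_relation[OF \<phi> rel] a_minus_def)
    also have "\<dots> = \<zero>"
      using c \<phi> unfolding pairing_def by (intro r_neg) simp
    finally show ?thesis .
  qed
  then show "a \<ominus>\<^bsub>FA\<^esub> b \<in> annihilator" using c by (simp add: annihilator_def)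
qed

lemma pairing_cong:
  assumes "test_function \<phi>" "f \<in> carrier FA" "g \<in> carrier FA" "cls f = cls g"
  shows "pairing \<phi> r f = pairing \<phi> r g"
proof -
  obtain i where i: "i \<in> I" "f = i \<oplus>\<^bsub>FA\<^esub> g"
    using F.coset_eqD[OF leavitt_ideal assms(2,4)] by blast
  then have "i \<in> annihilator" using leavitt_ideal_annihilator by blast
  then have "i \<in> carrier FA" "pairing \<phi> r i = \<zero>" using assms(1) by (auto simp: annihilator_def)
  then show ?thesis using assms i(2) by (simp add: pairing_def)
qed

section \<open>Degrees and closed walks\<close>

lemma act_degree: "act g (u, d, y) = Some (u', d', y') \<Longrightarrow> \<bar>d' - d\<bar> \<le> 1"
  by (cases g; simp split: if_splits; elim conjE; simp)

lemma run_degree: "run w (Some (u, d, y)) = Some (u', d', y') \<Longrightarrow> \<bar>d' - d\<bar> \<le> int (length w)"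
proof (induction w arbitrary: u d y)
  case (Cons g w)
  then obtain u1 d1 y1 where 1: "act g (u, d, y) = Some (u1, d1, y1)"
    "run w (Some (u1, d1, y1)) = Some (u', d', y')"
    by (cases "act g (u, d, y)") auto
  then show ?case using Cons.IH[OF 1(2)] act_degree[OF 1(1)] by simp
qed simp

text \<open>The walk is traversed backwards. No step is undefined, since a ghost arc only asks for
  the right vertex, and each step raises the degree by one.\<close>

lemma run_ghost_walk:
  "awalk u p v \<Longrightarrow> \<exists>y'. run (map Ghost (rev p)) (Some (v, d, y)) = Some (u, d + int (length p), y')"
proof (induction p arbitrary: u)
  case Nil
  then show ?case by (auto simp: awalk_Nil_iff)
next
  case (Cons e p)
  then have "awalk (head E e) p v" "u = tail E e" by (auto simp: awalk_Cons_iff)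
  moreover from Cons.IH[OF this(1)] obtain y' where
    "run (map Ghost (rev p)) (Some (v, d, y)) = Some (head E e, d + int (length p), y')" by blast
  ultimately show ?case by (auto simp: algebra_simps)
qed

lemma run_ghost_cycle:
  assumes "awalk u p u"
  shows "\<exists>y'. run (concat (replicate n (map Ghost (rev p)))) (Some (u, d, y))
    = Some (u, d + int (n * length p), y')"
proof (induction n arbitrary: d y)
  case (Suc n)
  obtain y1 where 1: "run (map Ghost (rev p)) (Some (u, d, y)) = Some (u, d + int (length p), y1)"
    using run_ghost_walk[OF assms] by blast
  show ?case using Suc[of "d + int (length p)" y1] 1 by (simp add: algebra_simps)
qed simp

lemma locally_finite_imp_acyclic:
  assumes lf: "locally_finite_algebra K Q"
  shows "acyclic_digraph E"
proof (rule ccontr)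
  assume "\<not> acyclic_digraph E"
  then obtain u p where p: "p \<noteq> []" "awalk u p u" by (auto simp: acyclic_digraph_def)
  define x where "x = (map Ghost (rev p) :: ('v, 'e) lpa_gen list)"
  have "set p \<subseteq> arcs E" using p(2) by (rule awalkE')
  then have x: "x \<in> words" using p(1) by (auto simp: x_def subset_iff)
  obtain B where B: "subalgebra_of K Q B" "finite_dim K Q B" "{wcls x} \<subseteq> B"
    using lf x unfolding locally_finite_algebra_def by (metis empty_subsetI finite.emptyI finite.insertI insert_subset wcls_closed)
  \<comment> \<open>The exponent is shifted by one to avoid the empty word.\<close>
  define pow where "pow n = concat (replicate (Suc n) x)" for n
  have pow: "pow n \<in> words \<and> wcls (pow n) \<in> B" for n
  proof (induction n)
    case 0
    then show ?case using x B(3) by (simp add: pow_def)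
  next
    case (Suc n)
    have "pow (Suc n) = x @ pow n" by (simp add: pow_def)
    then show ?case
      using Suc x wcls_append[of x "pow n"] B(1,3) by (auto simp: subalgebra_of_def)
  qed
  obtain T where T: "finite T" "T \<subseteq> B" "lin_span K Q T = B"
    using B(2) by (auto simp: finite_dim_def)
  have TQ: "T \<subseteq> cls ` carrier FA"
    using T(2) B(1) Q.submoduleE(1) Q_carrier by (auto simp: subalgebra_of_def)
  have "\<forall>t\<in>T. \<exists>f. f \<in> carrier FA \<and> t = cls f" using TQ by blast
  from bchoice[OF this] obtain r where r: "r t \<in> carrier FA" "t = cls (r t)" if "t \<in> T" for t
    by blast
  define W where "W = (\<Union>t\<in>T. {w. r t w \<noteq> \<zero>})"
  have "finite W" using T(1) r(1) finite_support by (simp add: W_def)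
  \<comment> \<open>The lengths of the words representing the spanning set \<open>T\<close> bound
    its displacements; the inserted \<open>0\<close> covers an empty \<open>W\<close>.\<close>
  define m where "m = Max (insert 0 (length ` W))"
  have m: "length w \<le> m" if "w \<in> W" for w
    using that \<open>finite W\<close> by (auto simp: m_def intro!: Max_ge)
  \<comment> \<open>This is the displacement caused by \<open>pow m\<close>; it exceeds
    \<open>m\<close> because \<open>p\<close> is nonempty.\<close>
  define N where "N = Suc m * length p"
  have N: "m < N" using p(1) by (cases p) (auto simp: N_def)
  \<comment> \<open>The functional detects degree \<open>int N\<close>, which words of length at
    most \<open>m\<close> cannot reach from degree 0.\<close>
  define \<phi> where "\<phi> = (\<lambda>s :: ('v \<times> int \<times> nat \<times> 'e list) option. case s of None \<Rightarrow> \<zero>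
    | Some (u, d, y) \<Rightarrow> if d = int N then \<one> else \<zero>)"
  have \<phi>: "test_function \<phi>" by (auto simp: test_function_def \<phi>_def split: option.split)
  define s where "s = Some (u, 0 :: int, 0 :: nat, [] :: 'e list)"
  have zero_on_T: "pairing \<phi> s (r t) = \<zero>" if t: "t \<in> T" for t
    unfolding pairing_def
  proof (rule lin_ext_eq_zeroI)
    show "\<phi> (run w s) \<in> carrier K" for w using \<phi> by simp
    fix w assume w: "r t w \<noteq> \<zero>"
    then have "length w < N" using m t N by (force simp: W_def)
    have "\<phi> (run w s) = \<zero>"
    proof (cases "run w s")
      case (Some z)
      then show ?thesis
        using run_degree[of w u 0 "(0, [])"] \<open>length w < N\<close>
        by (cases z) (auto simp: \<phi>_def s_def)
    qed (simp add: \<phi>_def)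
    then show "r t w \<otimes> \<phi> (run w s) = \<zero>" using r(1)[OF t] by simp
  qed
  \<comment> \<open>Asking for just one vanishing representative makes closure under the operations
    immediate; \<open>pairing_cong\<close> later carries the vanishing over to
    \<open>monomial (pow m)\<close>.\<close>
  define U where "U = cls ` {f \<in> carrier FA. pairing \<phi> s f = \<zero>}"
  have "submodule U K Q"
  proof (rule Q.submodule_criterion)
    show "U \<subseteq> carrier Q" by (auto simp: U_def)
    show "\<zero>\<^bsub>Q\<^esub> \<in> U" using \<phi> by (auto simp: U_def Q_zero pairing_def)
    show "a \<oplus>\<^bsub>Q\<^esub> b \<in> U" if "a \<in> U" "b \<in> U" for a b
      using that \<phi> by (auto simp: U_def Q_add pairing_def intro!: imageI)
    show "k \<odot>\<^bsub>Q\<^esub> a \<in> U" if "k \<in> carrier K" "a \<in> U" for k a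
      using that \<phi> by (auto simp: U_def Q_smult pairing_def intro!: imageI)
  qed
  moreover have "T \<subseteq> U"
    using r zero_on_T unfolding U_def by blast
  ultimately have "B \<subseteq> U" using Q.lin_span_least T(3) by blast
  then obtain f where f: "f \<in> carrier FA" "pairing \<phi> s f = \<zero>" "wcls (pow m) = cls f"
    using pow[of m] by (auto simp: U_def)
  have "pairing \<phi> s (monomial (pow m)) = \<zero>"
    using pairing_cong[OF \<phi> _ f(1,3)] pow[of m] monomial_closed f(2) by simp
  moreover have "pairing \<phi> s (monomial (pow m)) = \<one>"
  proof -
    obtain y where "run (pow m) s = Some (u, int N, y)"
      using run_ghost_cycle[OF p(2), of "Suc m" 0 "(0, [])"]
      unfolding pow_def x_def N_def s_def by auto
    then show ?thesis using pairing_monomial[OF \<phi>] by (simp add: \<phi>_def)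
  qed
  ultimately show False by simp
qed

end

theorem proposition4p4:
  fixes E :: "('v, 'e) pre_digraph"
    and K :: "('a, 'c) ring_scheme"
  assumes "wf_digraph E"
    and "field K"
  shows "locally_finite_algebra K (leavitt_path_algebra K E) \<longleftrightarrow> acyclic_digraph E"
proof -
  interpret leavitt E K using assms by (rule leavitt.intro)
  show ?thesis using acyclic_imp_locally_finite locally_finite_imp_acyclic by blast
qed

end
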